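(* For all $d,N\in\mathbb{Z}_{++}$, $L\ge2$, $\sigma^2>0$ and $\epsilon>0$, if the data are generated by the deep neural network process, then $$\mathbb{H}_\epsilon(A^{(1:L)})\le\frac{(L-2)N^2+N+dN}{2}\,\ln\Big(1+\frac{1}{\sigma^2(e^{2\epsilon/L}-1)}\Big).$$
   Context: Deep neural network process: the weight matrices $A^{(1)}\in\mathbb{R}^{N\times d}$, $A^{(\ell)}\in\mathbb{R}^{N\times N}$ for $2\le\ell\le L-1$, and $A^{(L)}\in\mathbb{R}^{1\times N}$ are mutually independent. All entries are i.i.d. centered Gaussian, with variance $1/d$ for $\ell=1$ and variance $1/N$ for $\ell\ge2$. The inputs $X_t$ are i.i.d. $\mathcal{N}(0,I_d)$. Set $U^{(0)}_t=X_t$ and $U^{(\ell)}_t=\mathrm{ReLU}(A^{(\ell)}U^{(\ell-1)}_t)$, with ReLU applied entrywise for $\ell=1,\ldots,L$. Labels are $Y_{t+1}=U^{(L)}_t+W_{t+1}$, where the $W_{t+1}$ are i.i.d. $\mathcal{N}(0,\sigma^2)$. Weights, inputs and noise are all independent. The history is $H_t=(X_0,Y_1,\ldots,Y_t,X_t)$, and $H_\infty$ is the whole sequence. With $\theta=A^{(1:L)}$, the rate-distortion function is $$\mathbb{H}_\epsilon(\theta)=\inf\{\mathbb{I}(\theta;\tilde\theta):\tilde\theta\perp H_\infty\mid\theta,\ \mathbb{I}(Y_1;\theta\mid\tilde\theta,X_0)\le\epsilon\}.$$ *)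

theory Defs
  imports "HOL-Probability.Probability"
begin

text \<open>KL divergence D(P||Q) as an extended nonnegative real: infinite unless P << Q;
  otherwise the integral of f ln f - f + 1 with f = dP/dQ (which equals the integral of
  f ln f for probability measures P, Q, and is pointwise nonnegative).\<close>
definition KLe :: "'a measure \<Rightarrow> 'a measure \<Rightarrow> ennreal" where
  "KLe P Q =
     (if sets P = sets Q \<and> absolutely_continuous Q P then
        (\<integral>\<^sup>+ x. ennreal (let f = enn2real (RN_deriv Q P x) in
                         if f = 0 then 1 else f * ln f - f + 1) \<partial>Q)
      else \<infinity>)"

definition MI :: "'o measure \<Rightarrow> 'x measure \<Rightarrow> 'y measure \<Rightarrow> ('o \<Rightarrow> 'x) \<Rightarrow> ('o \<Rightarrow> 'y) \<Rightarrow> ennreal" where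
  "MI M MX MY X Y = KLe (distr M (MX \<Otimes>\<^sub>M MY) (\<lambda>w. (X w, Y w))) (distr M MX X \<Otimes>\<^sub>M distr M MY Y)"

text \<open>Conditional mutual information I(X;Y|Z) via the chain rule
  I(X;Y|Z) = I(X;(Y,Z)) - I(X;Z), taken to be infinite when I(X;Z) is infinite.\<close>
definition condMI :: "'o measure \<Rightarrow> 'x measure \<Rightarrow> 'y measure \<Rightarrow> 'z measure \<Rightarrow>
    ('o \<Rightarrow> 'x) \<Rightarrow> ('o \<Rightarrow> 'y) \<Rightarrow> ('o \<Rightarrow> 'z) \<Rightarrow> ennreal" where
  "condMI M MX MY MZ X Y Z =
     (if MI M MX MZ X Z = \<infinity> then \<infinity>
      else MI M MX (MY \<Otimes>\<^sub>M MZ) X (\<lambda>w. (Y w, Z w)) - MI M MX MZ X Z)"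

type_synonym params = "nat \<times> nat \<times> nat \<Rightarrow> real"

text \<open>Weight entry (l,i,j) is A^(l)_{ij}.  Layer widths: n_0 = d, n_l = N (1 <= l <= L-1), n_L = 1.\<close>
definition width :: "nat \<Rightarrow> nat \<Rightarrow> nat \<Rightarrow> nat \<Rightarrow> nat" where
  "width d N L l = (if l = 0 then d else if l < L then N else 1)"

definition param_index :: "nat \<Rightarrow> nat \<Rightarrow> nat \<Rightarrow> (nat \<times> nat \<times> nat) set" where
  "param_index d N L = {(l, i, j). 1 \<le> l \<and> l \<le> L \<and> i < width d N L l \<and> j < width d N L (l - 1)}"

definition weight_sd :: "nat \<Rightarrow> nat \<Rightarrow> nat \<times> nat \<times> nat \<Rightarrow> real" where
  "weight_sd d N k = (case k of (l, i, j) \<Rightarrow> if l = 1 then sqrt (1 / real d) else sqrt (1 / real N))"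

definition gaussian :: "real \<Rightarrow> real measure" where
  "gaussian sd = density lborel (normal_density 0 sd)"

definition Theta_space :: "nat \<Rightarrow> nat \<Rightarrow> nat \<Rightarrow> params measure" where
  "Theta_space d N L = PiM (param_index d N L) (\<lambda>_. borel)"

definition Theta_prior :: "nat \<Rightarrow> nat \<Rightarrow> nat \<Rightarrow> params measure" where
  "Theta_prior d N L = PiM (param_index d N L) (\<lambda>k. gaussian (weight_sd d N k))"

definition X_space :: "nat \<Rightarrow> (nat \<Rightarrow> real) measure" where
  "X_space d = PiM {..<d} (\<lambda>_. borel)"

definition X_law :: "nat \<Rightarrow> (nat \<Rightarrow> real) measure" where
  "X_law d = PiM {..<d} (\<lambda>_. gaussian 1)"

fun net_U :: "nat \<Rightarrow> nat \<Rightarrow> nat \<Rightarrow> params \<Rightarrow> (nat \<Rightarrow> real) \<Rightarrow> nat \<Rightarrow> nat \<Rightarrow> real" where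
  "net_U d N L \<theta> x 0 = x"
| "net_U d N L \<theta> x (Suc l) =
     (\<lambda>i. max 0 (\<Sum>j < width d N L l. \<theta> (Suc l, i, j) * net_U d N L \<theta> x l j))"

definition net_out :: "nat \<Rightarrow> nat \<Rightarrow> nat \<Rightarrow> params \<Rightarrow> (nat \<Rightarrow> real) \<Rightarrow> real" where
  "net_out d N L \<theta> x = net_U d N L \<theta> x L 0"

text \<open>Joint law of (theta, theta~, X_0, W_1) when theta~ is drawn from the channel K(theta, .),
  conditionally independently of everything else given theta (so theta~ is conditionally
  independent of the whole history H_infinity given theta).  The remaining parts of
  H_infinity (X_t, W_{t+1} for t >= 1) are independent of all these and do not enter the
  quantities below.\<close>
definition joint_law :: "nat \<Rightarrow> nat \<Rightarrow> nat \<Rightarrow> real \<Rightarrow> (params \<Rightarrow> params measure)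
    \<Rightarrow> (((params \<times> params) \<times> (nat \<Rightarrow> real)) \<times> real) measure" where
  "joint_law d N L s2 K =
     ((bind (Theta_prior d N L)
        (\<lambda>\<theta>. distr (K \<theta>) (Theta_space d N L \<Otimes>\<^sub>M Theta_space d N L) (\<lambda>t. (\<theta>, t))))
     \<Otimes>\<^sub>M X_law d) \<Otimes>\<^sub>M gaussian (sqrt s2)"

definition dnn_rate_distortion :: "nat \<Rightarrow> nat \<Rightarrow> nat \<Rightarrow> real \<Rightarrow> real \<Rightarrow> ennreal" where
  "dnn_rate_distortion d N L s2 eps =
     (let \<Theta> = Theta_space d N L;
          th = (\<lambda>(((\<theta>, t), x), w). \<theta>);
          tt = (\<lambda>(((\<theta>, t), x), w). t);
          X0 = (\<lambda>(((\<theta>, t), x), w). x);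
          Y1 = (\<lambda>(((\<theta>, t), x), w). net_out d N L \<theta> x + w)
      in INF K \<in> {K. K \<in> measurable \<Theta> (prob_algebra \<Theta>) \<and>
                    condMI (joint_law d N L s2 K) borel \<Theta> (\<Theta> \<Otimes>\<^sub>M X_space d)
                       Y1 th (\<lambda>w. (tt w, X0 w)) \<le> ennreal eps}.
           MI (joint_law d N L s2 K) \<Theta> \<Theta> th tt)"

end

theory Submission
  imports Defs
begin

text \<open>Send each weight \<open>\<theta>\<^sub>k\<close> with prior \<open>N(0, s\<^sub>k\<^sup>2)\<close> through the Gaussian channel
  \<open>sqrt (1 - \<delta>) \<theta>\<^sub>k + sqrt \<delta> z\<^sub>k\<close>, where \<open>z\<close> is an independent copy of the prior.  The weight and its
  reproduction \<open>t\<close> have a symmetric joint density, so the channel costs \<open>ln (1 / \<delta>) / 2\<close> per weight and the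
  posterior of \<open>\<theta>\<close> given \<open>t\<close> is the law of \<open>sqrt (1 - \<delta>) t + sqrt \<delta> z\<close>.

  Since ReLU is a contraction and each weight matrix preserves the mean square of a layer, replacing
  \<open>\<theta>\<close> by its posterior mean \<open>sqrt (1 - \<delta>) t\<close> changes the output by at most \<open>L \<delta>\<close> in mean square.  By Gibbs'
  inequality, with \<open>N(f(sqrt (1 - \<delta>) t, x), \<sigma>\<^sup>2 + L \<delta>)\<close> in place of the law of \<open>Y\<close> given \<open>(t, x)\<close>,
  the conditional mutual information is at most \<open>ln (1 + L \<delta> / \<sigma>\<^sup>2) / 2\<close>.  For
  \<open>\<delta> = s / (1 + s)\<close> with \<open>s = \<sigma>\<^sup>2 (exp (2 \<epsilon> / L) - 1)\<close>, Bernoulli's inequality bounds this by \<open>\<epsilon>\<close>.\<close>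

section \<open>Divergence and mutual information from densities\<close>

text \<open>Two descriptions of one joint law carry the argument. The channel is given forward: draw
  \<theta>, then the reproduction t. The error estimate needs it backward, with t and the noise z
  independent and \<theta> built from them, because only then are the perturbations inside a layer
  orthogonal. As t again has the law of the prior, no layer amplifies an inherited error in mean
  square; each adds at most \<delta>, so the total is linear in L.

  Conditional mutual information is by definition a difference of two mutual informations of Y, one
  with (\<theta>, t, x) and one with (t, x). The law of Y is not explicit, but it enters both
  through the same integral of its log density and cancels. What remains is the exact entropy of the
  noise against the mean log of a Gaussian mixture. The variance of the Gaussian competitor equals
  the bound on the residual second moment, so that the quadratic terms of both sides are -1/2 and
  cancel too.

  The value of \<delta> comes from the rate: 1 / \<delta> = 1 + 1 / s is the argument of the claimed
  logarithm.\<close>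

lemma KLe_density:
  fixes g :: "'a \<Rightarrow> real"
  assumes "prob_space Q" "prob_space P"
    and g[measurable]: "g \<in> borel_measurable Q" and pos: "\<And>x. x \<in> space Q \<Longrightarrow> 0 < g x"
    and P: "P = density Q (\<lambda>x. ennreal (g x))"
    and int: "integrable P (\<lambda>x. ln (g x))"
  shows "KLe P Q = ennreal (\<integral>x. ln (g x) \<partial>P)" and "0 \<le> (\<integral>x. ln (g x) \<partial>P)"
proof -
  interpret Q: prob_space Q by fact
  interpret P: prob_space P by fact
  have nn: "AE x in Q. 0 \<le> g x" using pos by (intro AE_I2) (auto intro: less_imp_le)
  have int': "integrable Q (\<lambda>x. g x * ln (g x))"
    using int nn unfolding P by (subst (asm) integrable_density) auto
  have one: "(\<integral>\<^sup>+x. ennreal (g x) \<partial>Q) = 1"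
    using P.emeasure_space_1 unfolding P by (subst (asm) emeasure_density) (auto cong: nn_integral_cong)
  have intg: "integrable Q g"
    using one nn by (intro integrableI_nonneg) auto
  have intg1: "(\<integral>x. g x \<partial>Q) = 1"
    using one nn by (simp add: integral_eq_nn_integral)
  have ac: "absolutely_continuous Q P"
    unfolding P by (rule absolutely_continuousI_density) simp
  have phi_nonneg: "0 \<le> g x * ln (g x) - g x + 1" if "x \<in> space Q" for x
  proof -
    have "ln (1 / g x) \<le> 1 / g x - 1" using pos[OF that] by (intro ln_le_minus_one) simp
    then have "g x * ln (1 / g x) \<le> g x * (1 / g x - 1)"
      using pos[OF that] by (intro mult_left_mono) auto
    then show ?thesis using pos[OF that] by (simp add: ln_div algebra_simps)
  qed
  have AE: "AE x in Q. ennreal (g x) = RN_deriv Q P x"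
    using P[symmetric] by (intro Q.RN_deriv_unique) auto
  have "sets P = sets Q" unfolding P by simp
  then have "KLe P Q = (\<integral>\<^sup>+x. ennreal (let f = enn2real (RN_deriv Q P x) in
      if f = 0 then 1 else f * ln f - f + 1) \<partial>Q)"
    using ac by (simp add: KLe_def)
  also have "\<dots> = (\<integral>\<^sup>+x. ennreal (g x * ln (g x) - g x + 1) \<partial>Q)"
  \<comment> \<open>Positivity of g rules out the branch f = 0 of \<open>KLe\<close>.\<close>
  proof (rule nn_integral_cong_AE, use AE AE_space in eventually_elim)
    fix x assume "ennreal (g x) = RN_deriv Q P x" "x \<in> space Q"
    then show "ennreal (let f = enn2real (RN_deriv Q P x) in if f = 0 then 1 else f * ln f - f + 1)
      = ennreal (g x * ln (g x) - g x + 1)"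
      using pos[of x] by (simp add: Let_def less_imp_le flip: \<open>ennreal (g x) = _\<close>)
  qed
  also have "\<dots> = ennreal (\<integral>x. g x * ln (g x) - g x + 1 \<partial>Q)"
    using int' intg phi_nonneg by (intro nn_integral_eq_integral) auto
  \<comment> \<open>Both measures have mass one, so the summands -g + 1 integrate to zero.\<close>
  also have eq: "(\<integral>x. g x * ln (g x) - g x + 1 \<partial>Q) = (\<integral>x. ln (g x) \<partial>P)"
    using int' intg intg1 nn unfolding P by (subst integral_density) (auto simp: Q.prob_space)
  finally show "KLe P Q = ennreal (\<integral>x. ln (g x) \<partial>P)" .
  show "0 \<le> (\<integral>x. ln (g x) \<partial>P)"
    unfolding eq[symmetric] by (intro Bochner_Integration.integral_nonneg phi_nonneg)
qed

text \<open>Gibbs' inequality that also yields integrability of ln p: p * ln p is squeezed between p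
  * ln r + p - r, by ln u \<le> u - 1 at u = r / p, and p * ln C. The base measure may be infinite,
  as Lebesgue measure is.\<close>

lemma ln_density_integrable_Gibbs:
  fixes p r :: "'a \<Rightarrow> real"
  assumes prob: "prob_space (density B (\<lambda>x. ennreal (p x)))"
    and [measurable]: "p \<in> borel_measurable B" "r \<in> borel_measurable B"
    and p: "\<And>x. x \<in> space B \<Longrightarrow> 0 < p x" "\<And>x. x \<in> space B \<Longrightarrow> p x \<le> C"
    and r: "\<And>x. x \<in> space B \<Longrightarrow> 0 < r x" "(\<integral>\<^sup>+x. ennreal (r x) \<partial>B) \<le> 1"
    and ir: "integrable (density B (\<lambda>x. ennreal (p x))) (\<lambda>x. ln (r x))"
  shows "integrable (density B (\<lambda>x. ennreal (p x))) (\<lambda>x. ln (p x))"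
    and "(\<integral>x. ln (r x) \<partial>density B (\<lambda>x. ennreal (p x))) \<le> (\<integral>x. ln (p x) \<partial>density B (\<lambda>x. ennreal (p x)))"
proof -
  let ?P = "density B (\<lambda>x. ennreal (p x))"
  interpret P: prob_space ?P by fact
  have nn: "AE x in B. 0 \<le> p x" using p by (intro AE_I2) (auto intro: less_imp_le)
  have nnr: "AE x in B. 0 \<le> r x" using r by (intro AE_I2) (auto intro: less_imp_le)
  have one: "(\<integral>\<^sup>+x. ennreal (p x) \<partial>B) = 1"
    using P.emeasure_space_1 by (subst (asm) emeasure_density) (auto cong: nn_integral_cong)
  have ip: "integrable B p" using one nn by (intro integrableI_nonneg) auto
  have ip1: "(\<integral>x. p x \<partial>B) = 1" using one nn by (simp add: integral_eq_nn_integral)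
  have irr: "integrable B r" using r(2) nnr by (intro integrableI_nonneg) (auto simp: le_less_trans)
  have "ennreal (\<integral>x. r x \<partial>B) \<le> 1" using r(2) nnr irr by (subst nn_integral_eq_integral[symmetric]) auto
  then have ir1: "(\<integral>x. r x \<partial>B) \<le> 1" by simp
  have ipr: "integrable B (\<lambda>x. p x * ln (r x))"
    using ir nn by (subst (asm) integrable_density) auto
  have low: "p x * ln (r x) + p x - r x \<le> p x * ln (p x)" if "x \<in> space B" for x
  proof -
    have "ln (r x / p x) \<le> r x / p x - 1" using p r that by (intro ln_le_minus_one) simp
    then have "p x * ln (r x / p x) \<le> p x * (r x / p x - 1)"
      using p(1)[OF that] by (intro mult_left_mono) auto
    then show ?thesis using p(1)[OF that] r(1)[OF that] by (simp add: ln_div algebra_simps)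
  qed
  have up: "p x * ln (p x) \<le> p x * ln C" if "x \<in> space B" for x
    using p[OF that] by (intro mult_left_mono) auto
  have ipp: "integrable B (\<lambda>x. p x * ln (p x))"
  proof (rule Bochner_Integration.integrable_bound)
    show "integrable B (\<lambda>x. \<bar>p x * ln (r x)\<bar> + p x + r x + \<bar>p x * ln C\<bar>)"
      using ipr ip irr by (intro Bochner_Integration.integrable_add integrable_abs) auto
    show "AE x in B. norm (p x * ln (p x)) \<le> norm (\<bar>p x * ln (r x)\<bar> + p x + r x + \<bar>p x * ln C\<bar>)"
    proof (rule AE_I2)
      fix x assume x: "x \<in> space B"
      show "norm (p x * ln (p x)) \<le> norm (\<bar>p x * ln (r x)\<bar> + p x + r x + \<bar>p x * ln C\<bar>)"
        using low[OF x] up[OF x] p(1)[OF x] r(1)[OF x] unfolding real_norm_def by linarith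
    qed
  qed simp
  then show "integrable ?P (\<lambda>x. ln (p x))"
    using nn by (subst integrable_density) auto
  have "(\<integral>x. ln (r x) \<partial>?P) = (\<integral>x. p x * ln (r x) \<partial>B)"
    using nn by (subst integral_density) auto
  \<comment> \<open>The added terms integrate to 1 minus the mass of r, which is
    nonnegative.\<close>
  also have "\<dots> \<le> (\<integral>x. p x * ln (r x) + p x - r x \<partial>B)"
    using ip1 ir1 ipr ip irr by simp
  also have "\<dots> \<le> (\<integral>x. p x * ln (p x) \<partial>B)"
    using low ipr ip irr ipp by (intro integral_mono) auto
  also have "\<dots> = (\<integral>x. ln (p x) \<partial>?P)"
    using nn by (subst integral_density) auto
  finally show "(\<integral>x. ln (r x) \<partial>?P) \<le> (\<integral>x. ln (p x) \<partial>?P)" .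
qed

text \<open>Here p is the conditional density of Y given Z, so the joint law has density p / pY
  against the product of the marginals. The value is kept as a difference of two mean logarithms so
  that the term in pY can cancel later.\<close>

lemma MI_density:
  fixes Y :: "'o \<Rightarrow> real" and p :: "real \<times> 'z \<Rightarrow> real" and pY :: "real \<Rightarrow> real"
  assumes "prob_space M"
    and [measurable]: "Y \<in> borel_measurable M" "Z \<in> M \<rightarrow>\<^sub>M MZ"
    and [measurable]: "p \<in> borel_measurable (borel \<Otimes>\<^sub>M MZ)" "pY \<in> borel_measurable borel"
    and p: "\<And>y z. z \<in> space MZ \<Longrightarrow> 0 < p (y, z)" and pY: "\<And>y. 0 < pY y"
    and YZ: "distr M (borel \<Otimes>\<^sub>M MZ) (\<lambda>w. (Y w, Z w)) = density (lborel \<Otimes>\<^sub>M distr M MZ Z) (\<lambda>u. ennreal (p u))"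
    and Y: "distr M borel Y = density lborel (\<lambda>y. ennreal (pY y))"
    and ip: "integrable M (\<lambda>w. ln (p (Y w, Z w)))" and ipY: "integrable M (\<lambda>w. ln (pY (Y w)))"
  shows "MI M borel MZ Y Z = ennreal ((\<integral>w. ln (p (Y w, Z w)) \<partial>M) - (\<integral>w. ln (pY (Y w)) \<partial>M))"
    and "0 \<le> (\<integral>w. ln (p (Y w, Z w)) \<partial>M) - (\<integral>w. ln (pY (Y w)) \<partial>M)"
proof -
  interpret M: prob_space M by fact
  interpret Z: prob_space "distr M MZ Z" by (rule M.prob_space_distr) simp
  interpret Y: prob_space "distr M borel Y" by (rule M.prob_space_distr) simp
  interpret YZ: pair_prob_space "distr M borel Y" "distr M MZ Z" ..
  interpret lb: pair_sigma_finite lborel "distr M MZ Z" ..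
  let ?J = "distr M (borel \<Otimes>\<^sub>M MZ) (\<lambda>w. (Y w, Z w))"
  let ?Q = "distr M borel Y \<Otimes>\<^sub>M distr M MZ Z"
  define g where "g = (\<lambda>u. p u / pY (fst u))"
  have g[measurable]: "g \<in> borel_measurable (borel \<Otimes>\<^sub>M MZ)" unfolding g_def by measurable
  have Q: "?Q = density (lborel \<Otimes>\<^sub>M distr M MZ Z) (\<lambda>u. ennreal (pY (fst u)))"
  proof -
    have "?Q = density lborel (\<lambda>y. ennreal (pY y)) \<Otimes>\<^sub>M density (distr M MZ Z) (\<lambda>_. 1)"
      unfolding Y by (simp add: density_1)
    also have "\<dots> = density (lborel \<Otimes>\<^sub>M distr M MZ Z) (\<lambda>(x,y). ennreal (pY x) * 1)"
      by (rule pair_measure_density) (auto simp: density_1 intro: Z.sigma_finite_measure_axioms lborel.sigma_finite_measure_axioms)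
    finally show ?thesis by (simp add: split_beta')
  qed
  have J: "?J = density ?Q (\<lambda>u. ennreal (g u))"
    unfolding YZ Q
    by (subst density_density_eq)
       (auto intro!: density_cong AE_I2 simp: g_def space_pair_measure pY p ennreal_mult[symmetric] less_imp_le
         less_imp_neq[OF pY, symmetric])
  have [simp]: "ln (g (Y w, Z w)) = ln (p (Y w, Z w)) - ln (pY (Y w))" if "w \<in> space M" for w
    unfolding g_def using p[of "Z w" "Y w"] pY[of "Y w"] measurable_space[OF \<open>Z \<in> M \<rightarrow>\<^sub>M MZ\<close> that]
    by (simp add: ln_div)
  have "integrable M (\<lambda>w. ln (g (Y w, Z w)))"
    using ip ipY by (simp cong: Bochner_Integration.integrable_cong)
  then have iJ: "integrable ?J (\<lambda>u. ln (g u))" by (subst integrable_distr_eq) auto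
  have val: "(\<integral>u. ln (g u) \<partial>?J) = (\<integral>w. ln (p (Y w, Z w)) \<partial>M) - (\<integral>w. ln (pY (Y w)) \<partial>M)"
    using ip ipY by (subst integral_distr) (auto cong: Bochner_Integration.integral_cong)
  have gpos: "0 < g u" if "u \<in> space ?Q" for u
    using that p pY by (auto simp: g_def space_pair_measure)
  note KL = KLe_density[OF YZ.prob_space_axioms M.prob_space_distr[of "\<lambda>w. (Y w, Z w)" "borel \<Otimes>\<^sub>M MZ"] _ gpos J iJ]
  show "MI M borel MZ Y Z = ennreal ((\<integral>w. ln (p (Y w, Z w)) \<partial>M) - (\<integral>w. ln (pY (Y w)) \<partial>M))"
    unfolding MI_def val[symmetric] by (rule KL(1)) auto
  show "0 \<le> (\<integral>w. ln (p (Y w, Z w)) \<partial>M) - (\<integral>w. ln (pY (Y w)) \<partial>M)"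
    unfolding val[symmetric] by (rule KL(2)) auto
qed

section \<open>The Gaussian test channel\<close>

lemma sets_gaussian[simp, measurable_cong]: "sets (gaussian s) = sets borel"
  by (simp add: gaussian_def)

lemma space_gaussian[simp]: "space (gaussian s) = UNIV"
  by (simp add: gaussian_def)

lemma prob_space_gaussian: "0 < s \<Longrightarrow> prob_space (gaussian s)"
  unfolding gaussian_def by (rule prob_space_normal_density)

lemma gaussian_moments:
  assumes "0 < s"
  shows "integrable (gaussian s) (\<lambda>x. x)" "(\<integral>x. x \<partial>gaussian s) = 0"
    and "integrable (gaussian s) (\<lambda>x. x\<^sup>2)" "(\<integral>x. x\<^sup>2 \<partial>gaussian s) = s\<^sup>2"
proof -
  have 1: "has_bochner_integral lborel (\<lambda>x. normal_density 0 s x * (x - 0)) 0"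
    using normal_moment_odd[OF assms, of 0 0] by simp
  have 2: "has_bochner_integral lborel (\<lambda>x. normal_density 0 s x * (x - 0)^2) (s\<^sup>2)"
    using normal_moment_even[OF assms, of 0 1] by (simp add: field_simps power2_eq_square)
  show "integrable (gaussian s) (\<lambda>x. x)" "integrable (gaussian s) (\<lambda>x. x\<^sup>2)"
    unfolding gaussian_def using 1 2 by (auto simp: integrable_density has_bochner_integral_iff)
  show "(\<integral>x. x \<partial>gaussian s) = 0" "(\<integral>x. x\<^sup>2 \<partial>gaussian s) = s\<^sup>2"
    unfolding gaussian_def using 1 2 by (auto simp: integral_density has_bochner_integral_iff)
qed

lemma nn_integral_gaussian_affine_square:
  assumes s: "0 < s"
  shows "(\<integral>\<^sup>+y. ennreal ((A + y * v)\<^sup>2) \<partial>gaussian s) = ennreal (A\<^sup>2 + s\<^sup>2 * v\<^sup>2)"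
proof -
  interpret prob_space "gaussian s" by (rule prob_space_gaussian[OF s])
  have eq: "(\<lambda>y. (A + y * v)\<^sup>2) = (\<lambda>y. A\<^sup>2 + (2 * A * v) * y + v\<^sup>2 * y\<^sup>2)"
    by (auto simp: fun_eq_iff power2_eq_square algebra_simps)
  have "(\<integral>\<^sup>+y. ennreal ((A + y * v)\<^sup>2) \<partial>gaussian s) = ennreal (\<integral>y. (A + y * v)\<^sup>2 \<partial>gaussian s)"
    using gaussian_moments[OF s] by (intro nn_integral_eq_integral) (auto simp: eq)
  also have "(\<integral>y. (A + y * v)\<^sup>2 \<partial>gaussian s) = A\<^sup>2 + s\<^sup>2 * v\<^sup>2"
    using gaussian_moments[OF s] using prob_space by (simp add: eq)
  finally show ?thesis .
qed

text \<open>Density, with respect to \<open>N(0, s\<^sup>2)\<close>, of \<open>sqrt (1 - \<delta>) a + sqrt \<delta> z\<close> with \<open>z\<close> distributed as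
  \<open>N(0, s\<^sup>2)\<close>.  Its symmetry in \<open>a\<close> and \<open>b\<close> is what makes the test channel reversible.\<close>
definition mehler :: "real \<Rightarrow> real \<Rightarrow> real \<Rightarrow> real \<Rightarrow> real" where
  "mehler \<delta> s a b =
     exp (- ((1 - \<delta>) * a\<^sup>2 - 2 * sqrt (1 - \<delta>) * a * b + (1 - \<delta>) * b\<^sup>2) / (2 * \<delta> * s\<^sup>2)) / sqrt \<delta>"

lemma mehler_sym: "mehler \<delta> s a b = mehler \<delta> s b a"
  by (simp add: mehler_def algebra_simps)

lemma mehler_pos: "0 < \<delta> \<Longrightarrow> 0 < mehler \<delta> s a b"
  by (simp add: mehler_def)

lemma measurable_mehler[measurable]:
  assumes [measurable]: "f \<in> borel_measurable M" "g \<in> borel_measurable M"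
  shows "(\<lambda>w. mehler \<delta> s (f w) (g w)) \<in> borel_measurable M"
  unfolding mehler_def by measurable

lemma distr_gaussian_mehler:
  assumes s: "0 < s" and \<delta>: "0 < \<delta>" "\<delta> < 1"
  shows "distr (gaussian s) borel (\<lambda>b. sqrt (1 - \<delta>) * a + sqrt \<delta> * b) = density (gaussian s) (\<lambda>b. ennreal (mehler \<delta> s a b))"
proof -
  interpret prob_space "gaussian s" by (rule prob_space_gaussian[OF s])
  have "distr (gaussian s) lborel (\<lambda>x. x) = gaussian s"
    by (rule distr_id2) simp
  then have "distributed (gaussian s) lborel (\<lambda>x. x) (normal_density 0 s)"
    unfolding distributed_def by (auto simp: gaussian_def)
  from normal_density_affine[OF this s, of "sqrt \<delta>" "sqrt (1 - \<delta>) * a"] \<delta>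
  have "distr (gaussian s) lborel (\<lambda>b. sqrt (1 - \<delta>) * a + sqrt \<delta> * b) =
    density lborel (\<lambda>x. ennreal (normal_density (sqrt (1 - \<delta>) * a) (sqrt \<delta> * s) x))"
    by (simp add: distributed_def)
  also have "distr (gaussian s) lborel (\<lambda>b. sqrt (1 - \<delta>) * a + sqrt \<delta> * b) =
    distr (gaussian s) borel (\<lambda>b. sqrt (1 - \<delta>) * a + sqrt \<delta> * b)"
    by (rule distr_cong) auto
  also have "density lborel (\<lambda>x. ennreal (normal_density (sqrt (1 - \<delta>) * a) (sqrt \<delta> * s) x)) =
    density (gaussian s) (\<lambda>b. ennreal (mehler \<delta> s a b))"
  proof -
    have "normal_density (sqrt (1 - \<delta>) * a) (sqrt \<delta> * s) b = normal_density 0 s b * mehler \<delta> s a b" for b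
    proof -
      have r: "(sqrt (1 - \<delta>))\<^sup>2 = 1 - \<delta>" "(sqrt \<delta>)\<^sup>2 = \<delta>" using \<delta> by auto
      \<comment> \<open>The coefficient of b^2 splits as 1 / \<delta> = 1 + (1 - \<delta>) /
        \<delta>. The first part is the exponent of the prior; the second has the same factor 1 -
        \<delta> as a^2, hence the symmetry of \<open>mehler\<close>.\<close>
      have e1: "- (b - sqrt (1 - \<delta>) * a)\<^sup>2 / (2 * (sqrt \<delta> * s)\<^sup>2) =
        - (b - 0)\<^sup>2 / (2 * s\<^sup>2) + (- ((1 - \<delta>) * a\<^sup>2 - 2 * sqrt (1 - \<delta>) * a * b + (1 - \<delta>) * b\<^sup>2) / (2 * \<delta> * s\<^sup>2))"
        unfolding power2_diff power_mult_distrib r using s \<delta> by (simp add: field_simps)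
      have e2: "sqrt (2 * pi * (sqrt \<delta> * s)\<^sup>2) = sqrt (2 * pi * s\<^sup>2) * sqrt \<delta>"
        unfolding power_mult_distrib r by (simp add: real_sqrt_mult algebra_simps)
      show ?thesis unfolding normal_density_def mehler_def e1 e2 exp_add by simp
    qed
    then show ?thesis
      unfolding gaussian_def using mehler_pos[OF \<delta>(1)]
      by (subst density_density_eq) (auto simp: ennreal_mult' mehler_pos less_imp_le)
  qed
  finally show ?thesis .
qed

text \<open>Interpreted twice: for the weights with their prior standard deviations, and for the
  input coordinates with unit deviations.\<close>

locale gaussian_channel =
  fixes I :: "'i set" and s :: "'i \<Rightarrow> real" and \<delta> :: real
  assumes fin: "finite I" and s: "\<And>i. 0 < s i" and \<delta>: "0 < \<delta>" "\<delta> < 1"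
begin

definition "prior = PiM I (\<lambda>i. gaussian (s i))"

abbreviation "TS \<equiv> PiM I (\<lambda>_. borel :: real measure)"

text \<open>Free coefficients let one function give both the channel output \<open>mix\<close> and,
  with q = 0, the posterior mean. The restriction to I keeps values in the extensional product
  space.\<close>

definition chan :: "real \<Rightarrow> real \<Rightarrow> ('i \<Rightarrow> real) \<Rightarrow> ('i \<Rightarrow> real) \<Rightarrow> ('i \<Rightarrow> real)" where
  "chan r q t z = (\<lambda>k\<in>I. r * t k + q * z k)"

abbreviation "mix \<equiv> chan (sqrt (1 - \<delta>)) (sqrt \<delta>)"

text \<open>With the first component fixed, this is the density of the channel output relative to
  the prior; as a function of the pair it is the joint density of weight and reproduction relative
  to prior times prior.\<close>

definition "kern u = (\<Prod>k\<in>I. mehler \<delta> (s k) (fst u k) (snd u k))"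

sublocale G: product_prob_space "\<lambda>i. gaussian (s i)"
  by (rule product_prob_spaceI) (rule prob_space_gaussian[OF s])

lemma sets_prior[simp, measurable_cong]: "sets prior = sets TS"
  unfolding prior_def by (intro sets_PiM_cong) auto

lemma space_prior[simp]: "space prior = PiE I (\<lambda>_. UNIV)"
  unfolding prior_def by (simp add: space_PiM)

sublocale prior: prob_space prior
  unfolding prior_def by (rule prob_space_PiM) (rule prob_space_gaussian[OF s])

sublocale PP: pair_prob_space prior prior ..

lemma measurable_chan[measurable]:
  assumes [measurable]: "f \<in> M \<rightarrow>\<^sub>M TS" "g \<in> M \<rightarrow>\<^sub>M TS"
  shows "(\<lambda>w. chan r q (f w) (g w)) \<in> M \<rightarrow>\<^sub>M TS"
  unfolding chan_def by measurable

lemma measurable_kern[measurable]: "kern \<in> borel_measurable (TS \<Otimes>\<^sub>M TS)"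
  unfolding kern_def by measurable

lemma kern_pos: "0 < kern u"
  unfolding kern_def by (intro prod_pos mehler_pos \<delta>)

text \<open>Both sides equal the product of the one-dimensional output laws \<open>?N\<close>; by
  uniqueness of product measures it suffices to compare them on boxes.\<close>

lemma distr_chan: "distr prior TS (mix \<theta>) = density prior (\<lambda>t. ennreal (kern (\<theta>, t)))"
proof -
  let ?N = "\<lambda>k. density (gaussian (s k)) (\<lambda>b. ennreal (mehler \<delta> (s k) (\<theta> k) b))"
  let ?a = "\<lambda>k b. sqrt (1 - \<delta>) * \<theta> k + sqrt \<delta> * b"
  have N: "?N k = distr (gaussian (s k)) borel (?a k)" for k
    by (rule distr_gaussian_mehler[symmetric, OF s \<delta>])
  have pN: "prob_space (?N k)" for k
    unfolding N by (intro prob_space.prob_space_distr prob_space_gaussian s) auto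
  interpret N: product_prob_space ?N by (rule product_prob_spaceI) (rule pN)
  have setsN: "sets (PiM I ?N) = sets TS" by (intro sets_PiM_cong) auto
  have "distr prior TS (mix \<theta>) = PiM I ?N"
  proof (rule N.PiM_eqI[OF fin])
    fix A assume A: "\<And>i. i \<in> I \<Longrightarrow> A i \<in> sets (?N i)"
    then have A': "i \<in> I \<Longrightarrow> A i \<in> sets borel" for i by auto
    have [measurable]: "mix \<theta> \<in> prior \<rightarrow>\<^sub>M TS"
    proof -
      have "(\<lambda>z. \<lambda>k\<in>I. sqrt (1 - \<delta>) * \<theta> k + sqrt \<delta> * z k) \<in> prior \<rightarrow>\<^sub>M TS" by measurable
      then show ?thesis by (simp add: chan_def[abs_def])
    qed
    have "emeasure (distr prior TS (mix \<theta>)) (PiE I A) = emeasure prior (mix \<theta> -` PiE I A \<inter> space prior)"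
      using A' fin by (intro emeasure_distr) auto
    also have "mix \<theta> -` PiE I A \<inter> space prior = PiE I (\<lambda>k. ?a k -` A k)"
      by (auto simp: chan_def PiE_iff extensional_def)
    also have "emeasure prior \<dots> = (\<Prod>k\<in>I. emeasure (gaussian (s k)) (?a k -` A k))"
      unfolding prior_def
    proof (rule G.emeasure_PiM[OF fin])
      fix i assume "i \<in> I"
      then show "?a i -` A i \<in> sets (gaussian (s i))"
        using measurable_sets[of "?a i" "borel" borel "A i"] A' by auto
    qed
    also have "\<dots> = (\<Prod>k\<in>I. emeasure (?N k) (A k))"
      unfolding N using A' by (intro prod.cong refl) (subst emeasure_distr, auto)
    finally show "emeasure (distr prior TS (mix \<theta>)) (PiE I A) = (\<Prod>k\<in>I. emeasure (?N k) (A k))" .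
  qed (simp add: setsN)
  also have "PiM I ?N = density prior (\<lambda>t. ennreal (kern (\<theta>, t)))"
  proof (rule N.PiM_eqI[OF fin, symmetric])
    fix A assume A: "\<And>i. i \<in> I \<Longrightarrow> A i \<in> sets (?N i)"
    then have A'[measurable]: "i \<in> I \<Longrightarrow> A i \<in> sets borel" for i by auto
    have [measurable]: "(\<lambda>t. kern (\<theta>, t)) \<in> borel_measurable TS"
      unfolding kern_def by simp measurable
    have "emeasure (density prior (\<lambda>t. ennreal (kern (\<theta>, t)))) (PiE I A) =
        (\<integral>\<^sup>+t. ennreal (kern (\<theta>, t)) * indicator (PiE I A) t \<partial>prior)"
      using A' fin by (intro emeasure_density) auto
    also have "\<dots> = (\<integral>\<^sup>+t. (\<Prod>k\<in>I. ennreal (mehler \<delta> (s k) (\<theta> k) (t k)) * indicator (A k) (t k)) \<partial>prior)"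
    proof (rule nn_integral_cong)
      fix t assume t: "t \<in> space prior"
      have "indicator (PiE I A) t = (\<Prod>k\<in>I. indicator (A k) (t k) :: ennreal)"
        using t fin by (auto simp: indicator_def PiE_iff)
      then show "ennreal (kern (\<theta>, t)) * indicator (PiE I A) t =
        (\<Prod>k\<in>I. ennreal (mehler \<delta> (s k) (\<theta> k) (t k)) * indicator (A k) (t k))"
        by (simp add: kern_def prod.distrib prod_ennreal less_imp_le mehler_pos \<delta>)
    qed
    also have "\<dots> = (\<Prod>k\<in>I. \<integral>\<^sup>+b. ennreal (mehler \<delta> (s k) (\<theta> k) b) * indicator (A k) b \<partial>gaussian (s k))"
      unfolding prior_def by (intro G.product_nn_integral_prod fin) auto
    also have "\<dots> = (\<Prod>k\<in>I. emeasure (?N k) (A k))"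
      by (intro prod.cong refl emeasure_density[symmetric]) auto
    finally show "emeasure (density prior (\<lambda>t. ennreal (kern (\<theta>, t)))) (PiE I A) = (\<Prod>k\<in>I. emeasure (?N k) (A k))" .
  qed (simp add: setsN)
  finally show ?thesis .
qed

lemma nn_integral_chan:
  assumes [measurable]: "G \<in> borel_measurable (TS \<Otimes>\<^sub>M TS)" and "\<theta> \<in> space TS"
  shows "(\<integral>\<^sup>+z. G (\<theta>, mix \<theta> z) \<partial>prior) = (\<integral>\<^sup>+t. ennreal (kern (\<theta>, t)) * G (\<theta>, t) \<partial>prior)"
proof -
  note P = measurable_Pair1'[OF assms(2), of TS]
  have mix: "mix \<theta> \<in> prior \<rightarrow>\<^sub>M TS"
    by (rule measurable_chan[OF measurable_const[OF assms(2)] measurable_ident_sets[OF sets_prior]])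
  have G: "(\<lambda>t. G (\<theta>, t)) \<in> borel_measurable TS"
    by (rule measurable_compose[OF P assms(1)])
  have k: "(\<lambda>t. ennreal (kern (\<theta>, t))) \<in> borel_measurable prior"
    using measurable_compose[OF P measurable_kern] by (simp add: measurable_cong_sets[OF sets_prior refl])
  have "(\<integral>\<^sup>+z. G (\<theta>, mix \<theta> z) \<partial>prior) = (\<integral>\<^sup>+t. G (\<theta>, t) \<partial>distr prior TS (mix \<theta>))"
    using nn_integral_distr[OF mix, of "\<lambda>t. G (\<theta>, t)"] G by simp
  also have "\<dots> = (\<integral>\<^sup>+t. ennreal (kern (\<theta>, t)) * G (\<theta>, t) \<partial>prior)"
    unfolding distr_chan using nn_integral_density[OF k, of "\<lambda>t. G (\<theta>, t)"] G
    by (simp add: measurable_cong_sets[OF sets_prior refl])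
  finally show ?thesis .
qed

text \<open>Reversibility of the channel. Written with the kernel, the integral survives an exchange
  of the two variables, since \<open>kern\<close> is symmetric; read backward, t is drawn from the
  prior and the weight becomes the channel output.\<close>

lemma nn_integral_chan_reverse:
  assumes [measurable]: "G \<in> borel_measurable (TS \<Otimes>\<^sub>M TS)"
  shows "(\<integral>\<^sup>+\<theta>. \<integral>\<^sup>+z. G (\<theta>, mix \<theta> z) \<partial>prior \<partial>prior) = (\<integral>\<^sup>+t. \<integral>\<^sup>+z. G (mix t z, t) \<partial>prior \<partial>prior)"
proof -
  have sp: "space prior = space TS" by (rule sets_eq_imp_space_eq) simp
  have sym: "kern (a, b) = kern (b, a)" for a b
    by (simp add: kern_def mehler_sym)
  have "(\<integral>\<^sup>+\<theta>. \<integral>\<^sup>+z. G (\<theta>, mix \<theta> z) \<partial>prior \<partial>prior) = (\<integral>\<^sup>+\<theta>. \<integral>\<^sup>+t. ennreal (kern (\<theta>, t)) * G (\<theta>, t) \<partial>prior \<partial>prior)"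
    by (rule nn_integral_cong, rule nn_integral_chan[OF assms]) (simp only: sp)
  also have "\<dots> = (\<integral>\<^sup>+t. \<integral>\<^sup>+\<theta>. ennreal (kern (\<theta>, t)) * G (\<theta>, t) \<partial>prior \<partial>prior)"
    by (rule PP.Fubini'[symmetric]) measurable
  \<comment> \<open>The kernel is symmetric but G is not, so G is passed on with its arguments
    swapped.\<close>
  also have "\<dots> = (\<integral>\<^sup>+t. \<integral>\<^sup>+\<theta>. ennreal (kern (t, \<theta>)) * (\<lambda>(a, b). G (b, a)) (t, \<theta>) \<partial>prior \<partial>prior)"
    by (intro nn_integral_cong) (simp add: sym)
  also have "\<dots> = (\<integral>\<^sup>+t. \<integral>\<^sup>+z. (\<lambda>(a, b). G (b, a)) (t, mix t z) \<partial>prior \<partial>prior)"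
    by (rule nn_integral_cong, rule nn_integral_chan[symmetric], measurable) (simp only: sp)
  finally show ?thesis by simp
qed

end

section \<open>Integrals of functions that separate over a product\<close>

context pair_prob_space
begin

lemma integral_fst_only:
  fixes f :: "_ \<Rightarrow> real"
  assumes "integrable M1 f"
  shows "integrable (M1 \<Otimes>\<^sub>M M2) (\<lambda>u. f (fst u))" "(\<integral>u. f (fst u) \<partial>(M1 \<Otimes>\<^sub>M M2)) = (\<integral>x. f x \<partial>M1)"
proof -
  have [measurable]: "f \<in> borel_measurable M1" using assms by simp
  have "integrable (distr (M1 \<Otimes>\<^sub>M M2) M1 fst) f" unfolding M2.distr_pair_fst by fact
  then show "integrable (M1 \<Otimes>\<^sub>M M2) (\<lambda>u. f (fst u))" by (subst (asm) integrable_distr_eq) auto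
  have "(\<integral>x. f x \<partial>distr (M1 \<Otimes>\<^sub>M M2) M1 fst) = (\<integral>u. f (fst u) \<partial>(M1 \<Otimes>\<^sub>M M2))"
    by (rule integral_distr) auto
  then show "(\<integral>u. f (fst u) \<partial>(M1 \<Otimes>\<^sub>M M2)) = (\<integral>x. f x \<partial>M1)" unfolding M2.distr_pair_fst by simp
qed

lemma integrable_fst_times_snd:
  fixes f g :: "_ \<Rightarrow> real"
  assumes f: "integrable M1 f" and g: "integrable M2 g"
  shows "integrable (M1 \<Otimes>\<^sub>M M2) (\<lambda>u. f (fst u) * g (snd u))"
    "(\<integral>u. f (fst u) * g (snd u) \<partial>(M1 \<Otimes>\<^sub>M M2)) = (\<integral>x. f x \<partial>M1) * (\<integral>x. g x \<partial>M2)"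
proof -
  have [measurable]: "f \<in> borel_measurable M1" "g \<in> borel_measurable M2" using assms by simp_all
  show 1: "integrable (M1 \<Otimes>\<^sub>M M2) (\<lambda>u. f (fst u) * g (snd u))"
    using f g by (intro Fubini_integrable) (auto simp: abs_mult)
  show "(\<integral>u. f (fst u) * g (snd u) \<partial>(M1 \<Otimes>\<^sub>M M2)) = (\<integral>x. f x \<partial>M1) * (\<integral>x. g x \<partial>M2)"
    using integral_fst'[OF 1] by simp
qed

lemma integral_snd_only:
  fixes g :: "_ \<Rightarrow> real"
  assumes "integrable M2 g"
  shows "integrable (M1 \<Otimes>\<^sub>M M2) (\<lambda>u. g (snd u))" "(\<integral>u. g (snd u) \<partial>(M1 \<Otimes>\<^sub>M M2)) = (\<integral>x. g x \<partial>M2)"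
  using integrable_fst_times_snd[of "\<lambda>_. 1" g] assms M1.prob_space by auto

end

section \<open>Joint law and mutual information of source and reproduction\<close>

context gaussian_channel
begin

lemma prior_component:
  assumes k: "k \<in> I"
  shows "integrable prior (\<lambda>x. x k)" "(\<integral>x. x k \<partial>prior) = 0"
    and "integrable prior (\<lambda>x. (x k)\<^sup>2)" "(\<integral>x. (x k)\<^sup>2 \<partial>prior) = (s k)\<^sup>2"
proof -
  have d: "distr prior borel (\<lambda>x. x k) = gaussian (s k)"
  proof -
    have "distr prior borel (\<lambda>x. x k) = distr prior (gaussian (s k)) (\<lambda>x. x k)"
      by (rule distr_cong) auto
    also have "\<dots> = gaussian (s k)"
      unfolding prior_def by (rule distr_PiM_component[OF prob_space_gaussian[OF s] k])
    finally show ?thesis .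
  qed
  have [measurable]: "(\<lambda>x. x k) \<in> borel_measurable prior" using k by measurable
  note m = gaussian_moments[OF s, of k, folded d]
  show "integrable prior (\<lambda>x. x k)" using m(1) by (subst (asm) integrable_distr_eq) auto
  show "(\<integral>x. x k \<partial>prior) = 0" using m(2) by (subst (asm) integral_distr) auto
  show "integrable prior (\<lambda>x. (x k)\<^sup>2)" using m(3) by (subst (asm) integrable_distr_eq) auto
  show "(\<integral>x. (x k)\<^sup>2 \<partial>prior) = (s k)\<^sup>2" using m(4) by (subst (asm) integral_distr) auto
qed

text \<open>An image of two independent copies of the prior, which turns mean logarithms into
  Gaussian moments; \<open>bind_K\<close> shows that the channel produces this law.\<close>

definition "joint = distr (prior \<Otimes>\<^sub>M prior) (TS \<Otimes>\<^sub>M TS) (\<lambda>u. (fst u, mix (fst u) (snd u)))"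

lemma sets_joint[simp, measurable_cong]: "sets joint = sets (TS \<Otimes>\<^sub>M TS)"
  by (simp add: joint_def)

sublocale joint: prob_space joint
  unfolding joint_def by (rule PP.prob_space_distr) measurable

lemma sets_PP[measurable_cong]: "sets (prior \<Otimes>\<^sub>M prior) = sets (TS \<Otimes>\<^sub>M TS)"
  by (rule sets_pair_measure_cong) auto

lemma space_prior_TS: "space prior = space TS"
  by (rule sets_eq_imp_space_eq) simp

lemma nn_integral_joint:
  assumes [measurable]: "G \<in> borel_measurable (TS \<Otimes>\<^sub>M TS)"
  shows "(\<integral>\<^sup>+u. G u \<partial>joint) = (\<integral>\<^sup>+\<theta>. \<integral>\<^sup>+z. G (\<theta>, mix \<theta> z) \<partial>prior \<partial>prior)"
proof -
  have "(\<integral>\<^sup>+u. G u \<partial>joint) = (\<integral>\<^sup>+u. G (fst u, mix (fst u) (snd u)) \<partial>(prior \<Otimes>\<^sub>M prior))"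
    unfolding joint_def by (rule nn_integral_distr) measurable
  also have "\<dots> = (\<integral>\<^sup>+\<theta>. \<integral>\<^sup>+z. G (\<theta>, mix \<theta> z) \<partial>prior \<partial>prior)"
    by (subst prior.nn_integral_fst[symmetric]) simp_all
  finally show ?thesis .
qed

text \<open>Both marginals of \<open>joint\<close> turn out to be the prior, so \<open>kern\<close>
  is the density of the joint law against the product of its marginals, as \<open>KLe\<close>
  requires.\<close>

lemma joint_density: "joint = density (prior \<Otimes>\<^sub>M prior) (\<lambda>u. ennreal (kern u))"
proof (rule measure_eqI)
  show "sets joint = sets (density (prior \<Otimes>\<^sub>M prior) (\<lambda>u. ennreal (kern u)))"
    by (simp add: sets_PP)
  fix A assume A: "A \<in> sets joint"
  then have A'[measurable]: "A \<in> sets (TS \<Otimes>\<^sub>M TS)" by simp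
  have A'': "A \<in> sets (prior \<Otimes>\<^sub>M prior)" by (simp add: sets_PP)
  have "emeasure joint A = (\<integral>\<^sup>+u. indicator A u \<partial>joint)" using A by simp
  also have "\<dots> = (\<integral>\<^sup>+\<theta>. \<integral>\<^sup>+z. indicator A (\<theta>, mix \<theta> z) \<partial>prior \<partial>prior)"
    by (rule nn_integral_joint) measurable
  also have "\<dots> = (\<integral>\<^sup>+\<theta>. \<integral>\<^sup>+t. ennreal (kern (\<theta>, t)) * indicator A (\<theta>, t) \<partial>prior \<partial>prior)"
    by (rule nn_integral_cong, rule nn_integral_chan) (measurable, simp only: space_prior_TS)
  also have "\<dots> = (\<integral>\<^sup>+u. ennreal (kern u) * indicator A u \<partial>(prior \<Otimes>\<^sub>M prior))"
    by (rule prior.nn_integral_fst) measurable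
  also have "\<dots> = emeasure (density (prior \<Otimes>\<^sub>M prior) (\<lambda>u. ennreal (kern u))) A"
    using A'' by (intro emeasure_density[symmetric]) measurable
  finally show "emeasure joint A = emeasure (density (prior \<Otimes>\<^sub>M prior) (\<lambda>u. ennreal (kern u))) A" .
qed

lemma distr_joint_fst: "distr joint TS fst = prior"
proof -
  have "distr joint TS fst = distr (prior \<Otimes>\<^sub>M prior) TS (fst \<circ> (\<lambda>u. (fst u, mix (fst u) (snd u))))"
    unfolding joint_def by (rule distr_distr) measurable
  also have "\<dots> = distr (prior \<Otimes>\<^sub>M prior) prior fst"
    by (rule distr_cong) auto
  finally show ?thesis by (simp add: prior.distr_pair_fst)
qed

text \<open>In the reversed description t is the variable drawn from the prior, and z integrates
  out.\<close>

lemma distr_joint_snd: "distr joint TS snd = prior"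
proof (rule measure_eqI)
  fix A assume "A \<in> sets (distr joint TS snd)"
  then have A[measurable]: "A \<in> sets TS" by simp
  have "emeasure (distr joint TS snd) A = (\<integral>\<^sup>+u. indicator A u \<partial>distr joint TS snd)" by simp
  also have "\<dots> = (\<integral>\<^sup>+u. indicator A (snd u) \<partial>joint)"
    by (rule nn_integral_distr) measurable
  also have "\<dots> = (\<integral>\<^sup>+t. \<integral>\<^sup>+z. indicator A t \<partial>prior \<partial>prior)"
    by (subst nn_integral_joint, measurable)
       (use nn_integral_chan_reverse[of "\<lambda>u. indicator A (snd u)"] in simp)
  also have "\<dots> = emeasure prior A"
    using prior.emeasure_space_1 by simp
  finally show "emeasure (distr joint TS snd) A = emeasure prior A" .
qed simp

text \<open>At b = r * a + q * z the quadratic form is divisible by \<delta> = q^2 = 1 - r^2. This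
  cancels the \<delta> in the denominator and leaves a^2 and z^2 with opposite coefficients.\<close>

lemma ln_mehler_channel:
  assumes "0 < v"
  shows "ln (mehler \<delta> v a (sqrt (1 - \<delta>) * a + sqrt \<delta> * z)) =
    - ln \<delta> / 2 + (1 - \<delta>) / (2 * v\<^sup>2) * a\<^sup>2 + sqrt (1 - \<delta>) * sqrt \<delta> / v\<^sup>2 * (a * z) - (1 - \<delta>) / (2 * v\<^sup>2) * z\<^sup>2"
proof -
  define r q where "r = sqrt (1 - \<delta>)" and "q = sqrt \<delta>"
  have r: "1 - \<delta> = r\<^sup>2" and q: "\<delta> = q\<^sup>2" and rq: "r\<^sup>2 = 1 - q\<^sup>2" and q0: "q > 0"
    using \<delta> by (auto simp: r_def q_def)
  have "ln (mehler \<delta> v a b) = - ((1 - \<delta>) * a\<^sup>2 - 2 * r * a * b + (1 - \<delta>) * b\<^sup>2) / (2 * \<delta> * v\<^sup>2) - ln \<delta> / 2" for b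
    using \<delta> by (simp add: mehler_def ln_div ln_sqrt r_def)
  moreover have "(1 - \<delta>) * a\<^sup>2 - 2 * r * a * (r * a + q * z) + (1 - \<delta>) * (r * a + q * z)\<^sup>2 =
     \<delta> * (- r\<^sup>2 * a\<^sup>2 - 2 * r * q * (a * z) + r\<^sup>2 * z\<^sup>2)"
  proof -
    have "(1 - \<delta>) * a\<^sup>2 - 2 * r * a * (r * a + q * z) + (1 - \<delta>) * (r * a + q * z)\<^sup>2 =
      r\<^sup>2 * a\<^sup>2 * (r\<^sup>2 - 1) + 2 * r * q * a * z * (r\<^sup>2 - 1) + r\<^sup>2 * q\<^sup>2 * z\<^sup>2"
      unfolding r by (simp add: power2_eq_square algebra_simps)
    also have "\<dots> = q\<^sup>2 * (- r\<^sup>2 * a\<^sup>2 - 2 * r * q * (a * z) + r\<^sup>2 * z\<^sup>2)"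
      unfolding rq by (simp add: power2_eq_square algebra_simps)
    finally show ?thesis using q by simp
  qed
  ultimately have "ln (mehler \<delta> v a (r * a + q * z)) =
    - (\<delta> * (- r\<^sup>2 * a\<^sup>2 - 2 * r * q * (a * z) + r\<^sup>2 * z\<^sup>2)) / (2 * \<delta> * v\<^sup>2) - ln \<delta> / 2"
    by (simp only:)
  also have "\<dots> = - ln \<delta> / 2 + r\<^sup>2 / (2 * v\<^sup>2) * a\<^sup>2 + r * q / v\<^sup>2 * (a * z) - r\<^sup>2 / (2 * v\<^sup>2) * z\<^sup>2"
    using \<delta> assms by (simp add: field_simps)
  finally show ?thesis unfolding r_def[symmetric] q_def[symmetric] unfolding r .
qed

text \<open>In each coordinate a and z are independent and centred with equal variance: the two
  squares cancel in the mean, the product has mean zero, and every weight contributes -ln \<delta> /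
  2.\<close>

lemma ln_kern_joint:
  shows "integrable joint (\<lambda>u. ln (kern u))" and "(\<integral>u. ln (kern u) \<partial>joint) = real (card I) / 2 * ln (1 / \<delta>)"
proof -
  let ?F = "\<lambda>k u. - ln \<delta> / 2 + (1 - \<delta>) / (2 * (s k)\<^sup>2) * (fst u k)\<^sup>2
     + sqrt (1 - \<delta>) * sqrt \<delta> / (s k)\<^sup>2 * (fst u k * snd u k) - (1 - \<delta>) / (2 * (s k)\<^sup>2) * (snd u k)\<^sup>2"
  have F: "integrable (prior \<Otimes>\<^sub>M prior) (?F k)" "(\<integral>u. ?F k u \<partial>(prior \<Otimes>\<^sub>M prior)) = - ln \<delta> / 2"
    if k: "k \<in> I" for k
  proof -
    note c = prior_component[OF k]
    note i = PP.integral_fst_only[OF c(3)] PP.integral_snd_only[OF c(3)] PP.integrable_fst_times_snd[OF c(1) c(1)]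
    show "integrable (prior \<Otimes>\<^sub>M prior) (?F k)"
      using i by (intro Bochner_Integration.integrable_add Bochner_Integration.integrable_diff integrable_mult_right) auto
    show "(\<integral>u. ?F k u \<partial>(prior \<Otimes>\<^sub>M prior)) = - ln \<delta> / 2"
      using i c PP.prob_space by simp
  qed
  have eq: "ln (kern (fst u, mix (fst u) (snd u))) = (\<Sum>k\<in>I. ?F k u)" for u
  proof -
    have "ln (kern (fst u, mix (fst u) (snd u))) = (\<Sum>k\<in>I. ln (mehler \<delta> (s k) (fst u k) (mix (fst u) (snd u) k)))"
      unfolding kern_def by (simp add: ln_prod fin mehler_pos \<delta> less_imp_neq[OF mehler_pos, symmetric])
    then show ?thesis by (simp add: chan_def ln_mehler_channel[OF s])
  qed
  have [measurable]: "(\<lambda>u. ln (kern u)) \<in> borel_measurable (TS \<Otimes>\<^sub>M TS)" by measurable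
  show "integrable joint (\<lambda>u. ln (kern u))"
    unfolding joint_def using F by (subst integrable_distr_eq) (auto simp: eq)
  have "(\<integral>u. ln (kern u) \<partial>joint) = (\<integral>u. (\<Sum>k\<in>I. ?F k u) \<partial>(prior \<Otimes>\<^sub>M prior))"
    unfolding joint_def by (subst integral_distr) (auto simp: eq)
  also have "\<dots> = (\<Sum>k\<in>I. - ln \<delta> / 2)"
    using F by (subst Bochner_Integration.integral_sum) auto
  finally show "(\<integral>u. ln (kern u) \<partial>joint) = real (card I) / 2 * ln (1 / \<delta>)"
    using \<delta> by (simp add: ln_div)
qed

lemma MI_joint:
  assumes "prob_space M" and [measurable]: "th \<in> M \<rightarrow>\<^sub>M TS" "tt \<in> M \<rightarrow>\<^sub>M TS"
    and J: "distr M (TS \<Otimes>\<^sub>M TS) (\<lambda>w. (th w, tt w)) = joint"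
  shows "MI M TS TS th tt = ennreal (real (card I) / 2 * ln (1 / \<delta>))"
proof -
  have "distr M TS th = distr joint TS fst" "distr M TS tt = distr joint TS snd"
    unfolding J[symmetric] by (simp_all add: distr_distr comp_def)
  then have "MI M TS TS th tt = KLe joint (prior \<Otimes>\<^sub>M prior)"
    unfolding MI_def by (simp add: J distr_joint_fst distr_joint_snd)
  also have "\<dots> = ennreal (\<integral>u. ln (kern u) \<partial>joint)"
    by (rule KLe_density(1)[OF PP.prob_space_axioms joint.prob_space_axioms _ kern_pos joint_density ln_kern_joint(1)])
       measurable
  finally show ?thesis by (simp add: ln_kern_joint(2))
qed

end

section \<open>Observations with additive Gaussian noise\<close>

lemma measurable_normal_density_mean[measurable]:
  assumes [measurable]: "f \<in> borel_measurable M" "g \<in> borel_measurable M"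
  shows "(\<lambda>w. normal_density (f w) \<sigma> (g w)) \<in> borel_measurable M"
  unfolding normal_density_def by measurable

lemma normal_density_le: "0 < \<sigma> \<Longrightarrow> normal_density \<mu> \<sigma> x \<le> 1 / sqrt (2 * pi * \<sigma>\<^sup>2)"
  unfolding normal_density_def by (intro mult_left_le) auto

lemma ln_normal_density:
  "0 < \<sigma> \<Longrightarrow> ln (normal_density \<mu> \<sigma> x) = - (x - \<mu>)\<^sup>2 / (2 * \<sigma>\<^sup>2) - ln (2 * pi * \<sigma>\<^sup>2) / 2"
  unfolding normal_density_def by (simp add: ln_mult ln_div ln_sqrt)

lemma nn_integral_normal_density: "0 < \<sigma> \<Longrightarrow> (\<integral>\<^sup>+x. ennreal (normal_density \<mu> \<sigma> x) \<partial>lborel) = 1"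
  by (subst nn_integral_eq_integral) auto

lemma nn_integral_gaussian_shift:
  assumes [measurable]: "g \<in> borel_measurable borel"
  shows "(\<integral>\<^sup>+w. g (m + w) \<partial>gaussian \<sigma>) = (\<integral>\<^sup>+y. ennreal (normal_density m \<sigma> y) * g y \<partial>lborel)"
proof -
  have "(\<integral>\<^sup>+w. g (m + w) \<partial>gaussian \<sigma>) = (\<integral>\<^sup>+w. ennreal (normal_density 0 \<sigma> w) * g (m + w) \<partial>lborel)"
    unfolding gaussian_def by (rule nn_integral_density) auto
  also have "\<dots> = (\<integral>\<^sup>+y. ennreal (normal_density m \<sigma> y) * g y \<partial>lborel)"
    by (subst (2) nn_integral_real_affine[where c=1 and t=m]) (auto simp: normal_density_def)
  finally show ?thesis .
qed

text \<open>Allows each of the two mutual informations inside \<open>condMI\<close> to be computed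
  in a model of its own.\<close>

lemma MI_cong_law:
  assumes [measurable]: "X \<in> M \<rightarrow>\<^sub>M MX" "Y \<in> M \<rightarrow>\<^sub>M MY" "X' \<in> M' \<rightarrow>\<^sub>M MX" "Y' \<in> M' \<rightarrow>\<^sub>M MY"
    and law: "distr M (MX \<Otimes>\<^sub>M MY) (\<lambda>w. (X w, Y w)) = distr M' (MX \<Otimes>\<^sub>M MY) (\<lambda>w. (X' w, Y' w))"
  shows "MI M MX MY X Y = MI M' MX MY X' Y'"
proof -
  have "distr (distr M (MX \<Otimes>\<^sub>M MY) (\<lambda>w. (X w, Y w))) MX fst = distr M MX X"
    "distr (distr M (MX \<Otimes>\<^sub>M MY) (\<lambda>w. (X w, Y w))) MY snd = distr M MY Y"
    "distr (distr M' (MX \<Otimes>\<^sub>M MY) (\<lambda>w. (X' w, Y' w))) MX fst = distr M' MX X'"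
    "distr (distr M' (MX \<Otimes>\<^sub>M MY) (\<lambda>w. (X' w, Y' w))) MY snd = distr M' MY Y'"
    by (simp_all add: distr_distr comp_def)
  then show ?thesis using law by (simp add: MI_def)
qed

text \<open>The target spaces in \<open>MI\<close> supply only sigma-algebras, so a bare product
  space may be replaced by a law on it, such as \<open>R1\<close>.\<close>

lemma MI_cong_sets:
  assumes "sets MY = sets MY'"
  shows "MI M MX MY X Y = MI M MX MY' X Y"
proof -
  have "distr M (MX \<Otimes>\<^sub>M MY) f = distr M (MX \<Otimes>\<^sub>M MY') f" for f
    using assms by (intro distr_cong sets_pair_measure_cong) auto
  moreover have "distr M MY f = distr M MY' f" for f
    using assms by (intro distr_cong) auto
  ultimately show ?thesis by (simp add: MI_def)
qed

text \<open>A is drawn from R1 and observed, an independent variable from R2 stays hidden, and Y is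
  F of both plus Gaussian noise. Interpreted with A = (\<theta>, (t, x)) and with A = (t, x), one
  for each term of \<open>condMI\<close>. The second moment of F makes the log densities
  integrable.\<close>

locale additive_noise = R1: prob_space R1 + R2: prob_space R2
  for R1 :: "'a measure" and R2 :: "'b measure" +
  fixes F :: "'a \<times> 'b \<Rightarrow> real" and \<sigma> :: real
  assumes F[measurable]: "F \<in> borel_measurable (R1 \<Otimes>\<^sub>M R2)" and \<sigma>: "0 < \<sigma>"
    and F2: "(\<integral>\<^sup>+u. ennreal ((F u)\<^sup>2) \<partial>(R1 \<Otimes>\<^sub>M R2)) < \<infinity>"
begin

sublocale R12: pair_prob_space R1 R2 ..

sublocale W: prob_space "gaussian \<sigma>" by (rule prob_space_gaussian[OF \<sigma>])

sublocale P: pair_prob_space "R1 \<Otimes>\<^sub>M R2" "gaussian \<sigma>" ..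

definition "PP = (R1 \<Otimes>\<^sub>M R2) \<Otimes>\<^sub>M gaussian \<sigma>"
definition "Y u = F (fst u) + snd u"
definition "A u = fst (fst u)" for u :: "('a \<times> 'b) \<times> real"
text \<open>Conditional density of Y at \<open>fst v\<close> given A = \<open>snd v\<close>: a
  Gaussian mixture over the hidden variable.\<close>

definition "post v = (\<integral>b. normal_density (F (snd v, b)) \<sigma> (fst v) \<partial>R2)"
text \<open>The peak of the normal density, hence a uniform bound for every mixture of it.\<close>

definition "C = 1 / sqrt (2 * pi * \<sigma>\<^sup>2)"

sublocale PP: prob_space PP unfolding PP_def by (rule P.prob_space_axioms)

lemma sets_PP[measurable_cong]: "sets PP = sets ((R1 \<Otimes>\<^sub>M R2) \<Otimes>\<^sub>M borel)"
  unfolding PP_def by (rule sets_pair_measure_cong) auto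

lemma Y[measurable]: "Y \<in> borel_measurable PP" unfolding Y_def by measurable

lemma A[measurable]: "A \<in> PP \<rightarrow>\<^sub>M R1" unfolding A_def by measurable

lemma post_measurable[measurable]: "post \<in> borel_measurable (borel \<Otimes>\<^sub>M R1)"
  unfolding post_def by measurable

lemma post_integrable:
  assumes [measurable]: "a \<in> space R1"
  shows "integrable R2 (\<lambda>b. normal_density (F (a, b)) \<sigma> y)"
  by (rule R2.integrable_const_bound[of _ C]) (auto simp: C_def normal_density_le \<sigma>)

lemma ennreal_post:
  assumes [measurable]: "a \<in> space R1"
  shows "ennreal (post (y, a)) = (\<integral>\<^sup>+b. ennreal (normal_density (F (a, b)) \<sigma> y) \<partial>R2)"
  unfolding post_def by (subst nn_integral_eq_integral) (auto intro: post_integrable assms)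

lemma post_pos: "a \<in> space R1 \<Longrightarrow> 0 < post (y, a)"
  unfolding post_def using post_integrable[of a y]
  by (intro R2.expectation_greater AE_I2) (auto simp: normal_density_pos \<sigma>)

lemma post_le: "a \<in> space R1 \<Longrightarrow> post (y, a) \<le> C"
  unfolding post_def using post_integrable[of a y]
  by (auto intro!: R2.integral_le_const simp: C_def normal_density_le \<sigma>)

text \<open>The substitution y = F + w replaces the noise by a normal density in y with mean F;
  averaging it over the hidden variable produces \<open>post\<close>.\<close>

lemma nn_integral_Y_A:
  assumes [measurable]: "g \<in> borel_measurable (borel \<Otimes>\<^sub>M R1)"
  shows "(\<integral>\<^sup>+u. g (Y u, A u) \<partial>PP) = (\<integral>\<^sup>+y. \<integral>\<^sup>+a. ennreal (post (y, a)) * g (y, a) \<partial>R1 \<partial>lborel)"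
proof -
  interpret l1: pair_sigma_finite lborel R1 ..
  interpret l2: pair_sigma_finite lborel R2 ..
  have "(\<integral>\<^sup>+u. g (Y u, A u) \<partial>PP) = (\<integral>\<^sup>+v. \<integral>\<^sup>+w. g (F v + w, fst v) \<partial>gaussian \<sigma> \<partial>(R1 \<Otimes>\<^sub>M R2))"
    unfolding PP_def Y_def A_def by (subst W.nn_integral_fst[symmetric]) simp_all
  also have "\<dots> = (\<integral>\<^sup>+a. \<integral>\<^sup>+b. \<integral>\<^sup>+w. g (F (a, b) + w, a) \<partial>gaussian \<sigma> \<partial>R2 \<partial>R1)"
    by (subst R2.nn_integral_fst[symmetric]) simp_all
  also have "\<dots> = (\<integral>\<^sup>+a. \<integral>\<^sup>+b. \<integral>\<^sup>+y. ennreal (normal_density (F (a, b)) \<sigma> y) * g (y, a) \<partial>lborel \<partial>R2 \<partial>R1)"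
    by (intro nn_integral_cong nn_integral_gaussian_shift) simp
  also have "\<dots> = (\<integral>\<^sup>+a. \<integral>\<^sup>+y. \<integral>\<^sup>+b. ennreal (normal_density (F (a, b)) \<sigma> y) * g (y, a) \<partial>R2 \<partial>lborel \<partial>R1)"
  proof (rule nn_integral_cong)
    fix a assume a[measurable]: "a \<in> space R1"
    show "(\<integral>\<^sup>+b. \<integral>\<^sup>+y. ennreal (normal_density (F (a, b)) \<sigma> y) * g (y, a) \<partial>lborel \<partial>R2) =
      (\<integral>\<^sup>+y. \<integral>\<^sup>+b. ennreal (normal_density (F (a, b)) \<sigma> y) * g (y, a) \<partial>R2 \<partial>lborel)"
      by (rule l2.Fubini') measurable
  qed
  also have "\<dots> = (\<integral>\<^sup>+a. \<integral>\<^sup>+y. ennreal (post (y, a)) * g (y, a) \<partial>lborel \<partial>R1)"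
  proof (intro nn_integral_cong)
    fix a y assume a[measurable]: "a \<in> space R1"
    show "(\<integral>\<^sup>+b. ennreal (normal_density (F (a, b)) \<sigma> y) * g (y, a) \<partial>R2) = ennreal (post (y, a)) * g (y, a)"
      unfolding ennreal_post[OF a] by (rule nn_integral_multc) measurable
  qed
  also have "\<dots> = (\<integral>\<^sup>+y. \<integral>\<^sup>+a. ennreal (post (y, a)) * g (y, a) \<partial>R1 \<partial>lborel)"
    by (rule l1.Fubini') measurable
  finally show ?thesis .
qed

lemma law_Y_A: "distr PP (borel \<Otimes>\<^sub>M R1) (\<lambda>u. (Y u, A u)) = density (lborel \<Otimes>\<^sub>M R1) (\<lambda>v. ennreal (post v))"
proof (rule measure_eqI)
  fix B assume "B \<in> sets (distr PP (borel \<Otimes>\<^sub>M R1) (\<lambda>u. (Y u, A u)))"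
  then have B[measurable]: "B \<in> sets (borel \<Otimes>\<^sub>M R1)" by simp
  have B': "B \<in> sets (lborel \<Otimes>\<^sub>M R1)" using B by (simp cong: sets_pair_measure_cong)
  have "emeasure (distr PP (borel \<Otimes>\<^sub>M R1) (\<lambda>u. (Y u, A u))) B = (\<integral>\<^sup>+v. indicator B v \<partial>distr PP (borel \<Otimes>\<^sub>M R1) (\<lambda>u. (Y u, A u)))"
    by simp
  also have "\<dots> = (\<integral>\<^sup>+u. indicator B (Y u, A u) \<partial>PP)"
    by (rule nn_integral_distr) measurable
  also have "\<dots> = (\<integral>\<^sup>+y. \<integral>\<^sup>+a. ennreal (post (y, a)) * indicator B (y, a) \<partial>R1 \<partial>lborel)"
    by (rule nn_integral_Y_A) measurable
  also have "\<dots> = (\<integral>\<^sup>+v. ennreal (post v) * indicator B v \<partial>(lborel \<Otimes>\<^sub>M R1))"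
    by (rule R1.nn_integral_fst) measurable
  also have "\<dots> = emeasure (density (lborel \<Otimes>\<^sub>M R1) (\<lambda>v. ennreal (post v))) B"
    using B' by (intro emeasure_density[symmetric]) measurable
  finally show "emeasure (distr PP (borel \<Otimes>\<^sub>M R1) (\<lambda>u. (Y u, A u))) B =
    emeasure (density (lborel \<Otimes>\<^sub>M R1) (\<lambda>v. ennreal (post v))) B" .
qed (simp cong: sets_pair_measure_cong)

lemma distr_A: "distr PP R1 A = R1"
proof -
  have "distr PP R1 A = distr (distr PP (R1 \<Otimes>\<^sub>M R2) fst) R1 fst"
    by (subst distr_distr) (auto simp: A_def[abs_def] comp_def PP_def)
  also have "\<dots> = R1" unfolding PP_def W.distr_pair_fst R2.distr_pair_fst ..
  finally show ?thesis .
qed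

definition "marg y = (\<integral>a. post (y, a) \<partial>R1)"

lemma marg_measurable[measurable]: "marg \<in> borel_measurable borel"
  unfolding marg_def by measurable

lemma post_integrable_R1: "integrable R1 (\<lambda>a. post (y, a))"
  by (rule R1.integrable_const_bound[of _ C]) (auto simp: post_le post_pos less_imp_le)

lemma marg_pos: "0 < marg y"
  unfolding marg_def using post_integrable_R1[of y]
  by (intro R1.expectation_greater AE_I2) (auto simp: post_pos)

lemma marg_le: "marg y \<le> C"
  unfolding marg_def using post_integrable_R1[of y]
  by (auto intro!: R1.integral_le_const simp: post_le)

lemma law_Y: "distr PP borel Y = density lborel (\<lambda>y. ennreal (marg y))"
proof (rule measure_eqI)
  fix B assume "B \<in> sets (distr PP borel Y)"
  then have B[measurable]: "B \<in> sets borel" by simp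
  have m: "ennreal (marg y) = (\<integral>\<^sup>+a. ennreal (post (y, a)) \<partial>R1)" for y
    unfolding marg_def using post_integrable_R1[of y]
    by (subst nn_integral_eq_integral) (auto simp: post_pos less_imp_le)
  have "emeasure (distr PP borel Y) B = (\<integral>\<^sup>+v. indicator B v \<partial>distr PP borel Y)"
    by simp
  also have "\<dots> = (\<integral>\<^sup>+u. indicator B (Y u) \<partial>PP)"
    by (rule nn_integral_distr) measurable
  also have "\<dots> = (\<integral>\<^sup>+y. \<integral>\<^sup>+a. ennreal (post (y, a)) * indicator B y \<partial>R1 \<partial>lborel)"
    using nn_integral_Y_A[of "\<lambda>v. indicator B (fst v)"] by simp
  also have "\<dots> = (\<integral>\<^sup>+y. ennreal (marg y) * indicator B y \<partial>lborel)"
    unfolding m by (intro nn_integral_cong nn_integral_multc) measurable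
  also have "\<dots> = emeasure (density lborel (\<lambda>y. ennreal (marg y))) B"
    by (intro emeasure_density[symmetric]) measurable
  finally show "emeasure (distr PP borel Y) B = emeasure (density lborel (\<lambda>y. ennreal (marg y))) B" .
qed simp

text \<open>c predicts F from the observed variable. The noise is centred and independent of both,
  so its variance simply adds to the prediction error.\<close>

lemma residual_second_moment:
  assumes [measurable]: "c \<in> borel_measurable R1"
    and e: "(\<integral>\<^sup>+u. ennreal ((F u - c (fst u))\<^sup>2) \<partial>(R1 \<Otimes>\<^sub>M R2)) \<le> ennreal e" and "0 \<le> e"
  shows "integrable PP (\<lambda>u. (Y u - c (A u))\<^sup>2)" "(\<integral>u. (Y u - c (A u))\<^sup>2 \<partial>PP) \<le> \<sigma>\<^sup>2 + e"
proof -
  have "(\<integral>\<^sup>+u. ennreal ((Y u - c (A u))\<^sup>2) \<partial>PP) =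
      (\<integral>\<^sup>+v. \<integral>\<^sup>+w. ennreal (((F v - c (fst v)) + w * 1)\<^sup>2) \<partial>gaussian \<sigma> \<partial>(R1 \<Otimes>\<^sub>M R2))"
    unfolding PP_def Y_def A_def by (subst W.nn_integral_fst[symmetric]) (simp_all add: algebra_simps)
  also have "\<dots> = (\<integral>\<^sup>+v. ennreal ((F v - c (fst v))\<^sup>2) + ennreal (\<sigma>\<^sup>2) \<partial>(R1 \<Otimes>\<^sub>M R2))"
    unfolding nn_integral_gaussian_affine_square[OF \<sigma>] by simp
  also have "\<dots> = (\<integral>\<^sup>+v. ennreal ((F v - c (fst v))\<^sup>2) \<partial>(R1 \<Otimes>\<^sub>M R2)) + ennreal (\<sigma>\<^sup>2)"
    by (subst nn_integral_add) (auto simp: R12.emeasure_space_1)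
  also have "\<dots> \<le> ennreal e + ennreal (\<sigma>\<^sup>2)" by (intro add_mono e order_refl)
  finally have le: "(\<integral>\<^sup>+u. ennreal ((Y u - c (A u))\<^sup>2) \<partial>PP) \<le> ennreal (\<sigma>\<^sup>2 + e)"
    using \<open>0 \<le> e\<close> by (simp add: add.commute)
  then show i: "integrable PP (\<lambda>u. (Y u - c (A u))\<^sup>2)"
    by (intro integrableI_nonneg) (auto intro: le_less_trans)
  show "(\<integral>u. (Y u - c (A u))\<^sup>2 \<partial>PP) \<le> \<sigma>\<^sup>2 + e"
    using le \<open>0 \<le> e\<close> by (subst (asm) nn_integral_eq_integral[OF i]) (auto simp del: ennreal_plus)
qed

text \<open>The mixture \<open>post\<close> is compared with the single normal density of mean c and
  deviation \<tau>, whose mean logarithm needs only the residual second moment. The crude choice c =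
  0, \<tau> = 1 serves for integrability, a sharp one for the final bound.\<close>

lemma ln_post_lower_bound:
  assumes [measurable]: "c \<in> borel_measurable R1" and \<tau>: "0 < \<tau>"
    and e: "(\<integral>\<^sup>+u. ennreal ((F u - c (fst u))\<^sup>2) \<partial>(R1 \<Otimes>\<^sub>M R2)) \<le> ennreal e" and "0 \<le> e"
  shows "integrable PP (\<lambda>u. ln (post (Y u, A u)))"
    "- (\<sigma>\<^sup>2 + e) / (2 * \<tau>\<^sup>2) - ln (2 * pi * \<tau>\<^sup>2) / 2 \<le> (\<integral>u. ln (post (Y u, A u)) \<partial>PP)"
proof -
  interpret l1: pair_sigma_finite lborel R1 ..
  note m = residual_second_moment[OF assms(1) e \<open>0 \<le> e\<close>]
  let ?r = "\<lambda>v. normal_density (c (snd v)) \<tau> (fst v)"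
  let ?D = "density (lborel \<Otimes>\<^sub>M R1) (\<lambda>v. ennreal (post v))"
  have ln_r: "ln (?r (Y u, A u)) = - (Y u - c (A u))\<^sup>2 / (2 * \<tau>\<^sup>2) - ln (2 * pi * \<tau>\<^sup>2) / 2" for u
    by (simp add: ln_normal_density[OF \<tau>])
  have ir: "integrable PP (\<lambda>u. ln (?r (Y u, A u)))"
    unfolding ln_r using m(1) by simp
  have ir': "integrable ?D (\<lambda>v. ln (?r v))"
    using ir unfolding law_Y_A[symmetric] by (subst integrable_distr_eq) auto
  have "(\<integral>\<^sup>+v. ennreal (?r v) \<partial>(lborel \<Otimes>\<^sub>M R1)) = (\<integral>\<^sup>+a. \<integral>\<^sup>+y. ennreal (normal_density (c a) \<tau> y) \<partial>lborel \<partial>R1)"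
    by (subst l1.nn_integral_snd[symmetric]) simp_all
  also have "\<dots> = 1" by (simp add: nn_integral_normal_density[OF \<tau>] R1.emeasure_space_1)
  finally have one: "(\<integral>\<^sup>+v. ennreal (?r v) \<partial>(lborel \<Otimes>\<^sub>M R1)) \<le> 1" by simp
  have pD: "prob_space ?D" unfolding law_Y_A[symmetric] by (rule PP.prob_space_distr) measurable
  have sp: "snd v \<in> space R1" if "v \<in> space (lborel \<Otimes>\<^sub>M R1)" for v
    using that by (auto simp: space_pair_measure)
  note G = ln_density_integrable_Gibbs[OF pD, of ?r C]
  have G1: "integrable ?D (\<lambda>v. ln (post v))"
    by (rule G(1)[OF _ _ _ _ _ one ir']) (auto dest!: sp intro: post_pos post_le normal_density_pos \<tau>)
  have G2: "(\<integral>v. ln (?r v) \<partial>?D) \<le> (\<integral>v. ln (post v) \<partial>?D)"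
    by (rule G(2)[OF _ _ _ _ _ one ir']) (auto dest!: sp intro: post_pos post_le normal_density_pos \<tau>)
  show "integrable PP (\<lambda>u. ln (post (Y u, A u)))"
    using G1 unfolding law_Y_A[symmetric] by (subst (asm) integrable_distr_eq) auto
  have "- (\<sigma>\<^sup>2 + e) / (2 * \<tau>\<^sup>2) - ln (2 * pi * \<tau>\<^sup>2) / 2 \<le> - (\<integral>u. (Y u - c (A u))\<^sup>2 \<partial>PP) / (2 * \<tau>\<^sup>2) - ln (2 * pi * \<tau>\<^sup>2) / 2"
    using m(2) by (intro diff_right_mono divide_right_mono) auto
  also have "\<dots> = (\<integral>u. ln (?r (Y u, A u)) \<partial>PP)"
    unfolding ln_r using m(1) PP.prob_space by simp
  also have "\<dots> = (\<integral>v. ln (?r v) \<partial>?D)"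
    unfolding law_Y_A[symmetric] by (subst integral_distr) auto
  also note G2
  also have "(\<integral>v. ln (post v) \<partial>?D) = (\<integral>u. ln (post (Y u, A u)) \<partial>PP)"
    unfolding law_Y_A[symmetric] by (subst integral_distr) auto
  finally show "- (\<sigma>\<^sup>2 + e) / (2 * \<tau>\<^sup>2) - ln (2 * pi * \<tau>\<^sup>2) / 2 \<le> (\<integral>u. ln (post (Y u, A u)) \<partial>PP)" .
qed

text \<open>Y has a finite second moment, so the standard normal density is an admissible competitor
  in Gibbs' inequality. The density pY is arbitrary because both models are to be used with one and
  the same version.\<close>

lemma ln_density_Y_integrable:
  fixes pY :: "real \<Rightarrow> real"
  assumes [measurable]: "pY \<in> borel_measurable borel"
    and pY: "\<And>y. 0 < pY y" "\<And>y. pY y \<le> K" "distr PP borel Y = density lborel (\<lambda>y. ennreal (pY y))"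
  shows "integrable PP (\<lambda>u. ln (pY (Y u)))"
proof -
  obtain e where e: "0 \<le> e" "(\<integral>\<^sup>+u. ennreal ((F u)\<^sup>2) \<partial>(R1 \<Otimes>\<^sub>M R2)) = ennreal e"
    using F2 by (metis ennreal_cases less_irrefl infinity_ennreal_def)
  have m: "integrable PP (\<lambda>u. (Y u)\<^sup>2)"
    using residual_second_moment(1)[of "\<lambda>_. 0" e] e by simp
  have "integrable PP (\<lambda>u. ln (normal_density 0 1 (Y u)))"
    unfolding ln_normal_density[OF zero_less_one] using m by simp
  then have "integrable (distr PP borel Y) (\<lambda>y. ln (normal_density 0 1 y))"
    by (subst integrable_distr_eq) auto
  then have i: "integrable (density lborel (\<lambda>y. ennreal (pY y))) (\<lambda>y. ln (normal_density 0 1 y))"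
    unfolding pY(3) .
  have pD: "prob_space (density lborel (\<lambda>y. ennreal (pY y)))"
    unfolding pY(3)[symmetric] by (rule PP.prob_space_distr) measurable
  have "integrable (distr PP borel Y) (\<lambda>y. ln (pY y))"
    unfolding pY(3)
    by (rule ln_density_integrable_Gibbs(1)[OF pD _ _ pY(1) pY(2) _ _ i])
       (auto simp: nn_integral_normal_density normal_density_pos)
  then show ?thesis by (subst (asm) integrable_distr_eq) auto
qed

text \<open>The term in pY is an integral over the law of Y and not over \<open>PP\<close>, so it is
  literally the same real number in two models that share this law.\<close>

lemma MI_additive_noise:
  fixes pY :: "real \<Rightarrow> real"
  assumes [measurable]: "pY \<in> borel_measurable borel"
    and pY: "\<And>y. 0 < pY y" "\<And>y. pY y \<le> K" "distr PP borel Y = density lborel (\<lambda>y. ennreal (pY y))"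
  shows "MI PP borel R1 Y A =
      ennreal ((\<integral>u. ln (post (Y u, A u)) \<partial>PP) - (\<integral>y. ln (pY y) \<partial>density lborel (\<lambda>y. ennreal (pY y))))"
    "0 \<le> (\<integral>u. ln (post (Y u, A u)) \<partial>PP) - (\<integral>y. ln (pY y) \<partial>density lborel (\<lambda>y. ennreal (pY y)))"
proof -
  obtain e where e: "0 \<le> e" "(\<integral>\<^sup>+u. ennreal ((F u)\<^sup>2) \<partial>(R1 \<Otimes>\<^sub>M R2)) = ennreal e"
    using F2 by (metis ennreal_cases less_irrefl infinity_ennreal_def)
  have ip: "integrable PP (\<lambda>u. ln (post (Y u, A u)))"
    using ln_post_lower_bound(1)[of "\<lambda>_. 0" 1 e] e by simp
  have eq: "(\<integral>y. ln (pY y) \<partial>density lborel (\<lambda>y. ennreal (pY y))) = (\<integral>u. ln (pY (Y u)) \<partial>PP)"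
    unfolding pY(3)[symmetric] by (subst integral_distr) auto
  note MI = MI_density[OF PP.prob_space_axioms Y A post_measurable assms(1) post_pos pY(1) _ pY(3) ip
      ln_density_Y_integrable[OF assms]]
  show "MI PP borel R1 Y A =
      ennreal ((\<integral>u. ln (post (Y u, A u)) \<partial>PP) - (\<integral>y. ln (pY y) \<partial>density lborel (\<lambda>y. ennreal (pY y))))"
    unfolding eq by (rule MI(1)) (simp_all add: distr_A law_Y_A)
  show "0 \<le> (\<integral>u. ln (post (Y u, A u)) \<partial>PP) - (\<integral>y. ln (pY y) \<partial>density lborel (\<lambda>y. ennreal (pY y)))"
    unfolding eq by (rule MI(2)) (simp_all add: distr_A law_Y_A)
qed

text \<open>If the hidden variable does not influence F, then \<open>post\<close> is the noise
  density centred at f, and the result is minus the entropy of the noise; -1/2 is the mean of -w^2 /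
  (2 \<sigma>^2).\<close>

lemma ln_post_noiseless:
  assumes "\<And>a b. a \<in> space R1 \<Longrightarrow> b \<in> space R2 \<Longrightarrow> F (a, b) = f a"
  shows "(\<integral>u. ln (post (Y u, A u)) \<partial>PP) = - 1 / 2 - ln (2 * pi * \<sigma>\<^sup>2) / 2"
proof -
  have p: "post (y, a) = normal_density (f a) \<sigma> y" if "a \<in> space R1" for y a
    unfolding post_def using assms[OF that] R2.prob_space by (simp cong: Bochner_Integration.integral_cong)
  have "(\<integral>u. ln (post (Y u, A u)) \<partial>PP) = (\<integral>u. - (snd u)\<^sup>2 / (2 * \<sigma>\<^sup>2) - ln (2 * pi * \<sigma>\<^sup>2) / 2 \<partial>PP)"
    using assms by (intro Bochner_Integration.integral_cong)
      (auto simp: PP_def space_pair_measure A_def Y_def p ln_normal_density[OF \<sigma>])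
  also have "\<dots> = - 1 / 2 - ln (2 * pi * \<sigma>\<^sup>2) / 2"
    unfolding PP_def using P.integral_snd_only[OF gaussian_moments(3)[OF \<sigma>]] gaussian_moments(4)[OF \<sigma>] P.prob_space \<sigma>
    by simp
  finally show ?thesis .
qed

end

section \<open>Second moments by resampling a coordinate\<close>

text \<open>\<open>r \<omega> y\<close> overwrites one coordinate of \<open>\<omega>\<close> by \<open>y\<close>; a random variable that is invariant under
  \<open>r\<close> is independent of that coordinate.  This form of independence allows second moments to be
  computed with nonnegative integrals, without integrability side conditions.\<close>
definition resampling :: "'a measure \<Rightarrow> real \<Rightarrow> ('a \<Rightarrow> real \<Rightarrow> 'a) \<Rightarrow> bool" where
  "resampling M s r \<longleftrightarrow> 0 < s \<and> (\<lambda>u. r (fst u) (snd u)) \<in> M \<Otimes>\<^sub>M borel \<rightarrow>\<^sub>M M \<and>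
     (\<forall>G\<in>borel_measurable M. (\<integral>\<^sup>+\<omega>. G \<omega> \<partial>M) = (\<integral>\<^sup>+\<omega>. \<integral>\<^sup>+y. G (r \<omega> y) \<partial>gaussian s \<partial>M))"

lemma nn_integral_resample:
  "resampling M s r \<Longrightarrow> G \<in> borel_measurable M \<Longrightarrow>
    (\<integral>\<^sup>+\<omega>. G \<omega> \<partial>M) = (\<integral>\<^sup>+\<omega>. \<integral>\<^sup>+y. G (r \<omega> y) \<partial>gaussian s \<partial>M)"
  unfolding resampling_def by blast

lemma resampling_fst:
  assumes "prob_space M1" "prob_space M2" and r: "resampling M1 s r"
  shows "resampling (M1 \<Otimes>\<^sub>M M2) s (\<lambda>u y. (r (fst u) y, snd u))"
proof -
  interpret M1: prob_space M1 by fact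
  interpret M2: prob_space M2 by fact
  have s: "0 < s" and m[measurable]: "(\<lambda>u. r (fst u) (snd u)) \<in> M1 \<Otimes>\<^sub>M borel \<rightarrow>\<^sub>M M1"
    using r unfolding resampling_def by blast+
  interpret g: prob_space "gaussian s" by (rule prob_space_gaussian[OF s])
  interpret g2: pair_sigma_finite "gaussian s" M2 ..
  have [measurable]: "(\<lambda>w. r (f w) (h w)) \<in> M \<rightarrow>\<^sub>M M1"
    if [measurable]: "f \<in> M \<rightarrow>\<^sub>M M1" "h \<in> borel_measurable M" for f h and M :: "'c measure"
    using measurable_compose[OF measurable_Pair[OF that] m] by simp
  have "(\<integral>\<^sup>+\<omega>. G \<omega> \<partial>(M1 \<Otimes>\<^sub>M M2)) =
      (\<integral>\<^sup>+u. \<integral>\<^sup>+y. G (r (fst u) y, snd u) \<partial>gaussian s \<partial>(M1 \<Otimes>\<^sub>M M2))"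
    if [measurable]: "G \<in> borel_measurable (M1 \<Otimes>\<^sub>M M2)" for G
  proof -
    have "(\<integral>\<^sup>+\<omega>. G \<omega> \<partial>(M1 \<Otimes>\<^sub>M M2)) = (\<integral>\<^sup>+a. (\<integral>\<^sup>+b. G (a, b) \<partial>M2) \<partial>M1)"
      by (rule M2.nn_integral_fst[symmetric]) measurable
    also have "\<dots> = (\<integral>\<^sup>+a. \<integral>\<^sup>+y. (\<integral>\<^sup>+b. G (r a y, b) \<partial>M2) \<partial>gaussian s \<partial>M1)"
    proof -
      have "(\<lambda>a. \<integral>\<^sup>+b. G (a, b) \<partial>M2) \<in> borel_measurable M1" by measurable
      then show ?thesis by (rule nn_integral_resample[OF r])
    qed
    also have "\<dots> = (\<integral>\<^sup>+a. \<integral>\<^sup>+b. \<integral>\<^sup>+y. G (r a y, b) \<partial>gaussian s \<partial>M2 \<partial>M1)"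
    proof (rule nn_integral_cong)
      fix a assume [measurable]: "a \<in> space M1"
      show "(\<integral>\<^sup>+y. \<integral>\<^sup>+b. G (r a y, b) \<partial>M2 \<partial>gaussian s) = (\<integral>\<^sup>+b. \<integral>\<^sup>+y. G (r a y, b) \<partial>gaussian s \<partial>M2)"
        by (rule g2.Fubini'[symmetric]) measurable
    qed
    also have "\<dots> = (\<integral>\<^sup>+u. \<integral>\<^sup>+y. G (r (fst u) y, snd u) \<partial>gaussian s \<partial>(M1 \<Otimes>\<^sub>M M2))"
      by (subst M2.nn_integral_fst[symmetric]) simp_all
    finally show ?thesis .
  qed
  note * = this
  show ?thesis unfolding resampling_def
  proof (intro conjI ballI)
    show "0 < s" by (rule s)
  qed (measurable, erule *)
qed

lemma resampling_snd:
  assumes "prob_space M1" "prob_space M2" and r: "resampling M2 s r"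
  shows "resampling (M1 \<Otimes>\<^sub>M M2) s (\<lambda>u y. (fst u, r (snd u) y))"
proof -
  interpret M2: prob_space M2 by fact
  have s: "0 < s" and m[measurable]: "(\<lambda>u. r (fst u) (snd u)) \<in> M2 \<Otimes>\<^sub>M borel \<rightarrow>\<^sub>M M2"
    using r unfolding resampling_def by blast+
  interpret g: prob_space "gaussian s" by (rule prob_space_gaussian[OF s])
  have [measurable]: "(\<lambda>w. r (f w) (h w)) \<in> M \<rightarrow>\<^sub>M M2"
    if [measurable]: "f \<in> M \<rightarrow>\<^sub>M M2" "h \<in> borel_measurable M" for f h and M :: "'c measure"
    using measurable_compose[OF measurable_Pair[OF that] m] by simp
  have "(\<integral>\<^sup>+\<omega>. G \<omega> \<partial>(M1 \<Otimes>\<^sub>M M2)) =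
      (\<integral>\<^sup>+u. \<integral>\<^sup>+y. G (fst u, r (snd u) y) \<partial>gaussian s \<partial>(M1 \<Otimes>\<^sub>M M2))"
    if [measurable]: "G \<in> borel_measurable (M1 \<Otimes>\<^sub>M M2)" for G
  proof -
    have "(\<integral>\<^sup>+\<omega>. G \<omega> \<partial>(M1 \<Otimes>\<^sub>M M2)) = (\<integral>\<^sup>+a. (\<integral>\<^sup>+b. G (a, b) \<partial>M2) \<partial>M1)"
      by (rule M2.nn_integral_fst[symmetric]) measurable
    also have "\<dots> = (\<integral>\<^sup>+a. \<integral>\<^sup>+b. \<integral>\<^sup>+y. G (a, r b y) \<partial>gaussian s \<partial>M2 \<partial>M1)"
    proof (rule nn_integral_cong)
      fix a assume [measurable]: "a \<in> space M1"
      have "(\<lambda>b. G (a, b)) \<in> borel_measurable M2" by measurable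
      then show "(\<integral>\<^sup>+b. G (a, b) \<partial>M2) = (\<integral>\<^sup>+b. \<integral>\<^sup>+y. G (a, r b y) \<partial>gaussian s \<partial>M2)"
        by (rule nn_integral_resample[OF r])
    qed
    also have "\<dots> = (\<integral>\<^sup>+u. \<integral>\<^sup>+y. G (fst u, r (snd u) y) \<partial>gaussian s \<partial>(M1 \<Otimes>\<^sub>M M2))"
      by (subst M2.nn_integral_fst[symmetric]) simp_all
    finally show ?thesis .
  qed
  note * = this
  show ?thesis unfolding resampling_def
  proof (intro conjI ballI)
    show "0 < s" by (rule s)
  qed (measurable, erule *)
qed

text \<open>Coefficients are peeled off one by one. Resampling c k fixes v k and the remaining sum,
  so the cross term has mean zero and only the variance s^2 times the square of v k is
  added.\<close>

lemma second_moment_sum: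
  fixes c v :: "'j \<Rightarrow> 'a \<Rightarrow> real"
  assumes "finite J" and r: "\<And>j. j \<in> J \<Longrightarrow> resampling M s (r j)"
    and A[measurable]: "A \<in> borel_measurable M"
    and c[measurable]: "\<And>j. j \<in> J \<Longrightarrow> c j \<in> borel_measurable M"
    and v[measurable]: "\<And>j. j \<in> J \<Longrightarrow> v j \<in> borel_measurable M"
    and inv: "\<And>j \<omega> y. j \<in> J \<Longrightarrow> A (r j \<omega> y) = A \<omega>"
      "\<And>j \<omega> y. j \<in> J \<Longrightarrow> c j (r j \<omega> y) = y"
      "\<And>j j' \<omega> y. j \<in> J \<Longrightarrow> j' \<in> J \<Longrightarrow> j' \<noteq> j \<Longrightarrow> c j' (r j \<omega> y) = c j' \<omega>"
      "\<And>j j' \<omega> y. j \<in> J \<Longrightarrow> j' \<in> J \<Longrightarrow> v j' (r j \<omega> y) = v j' \<omega>"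
  shows "(\<integral>\<^sup>+\<omega>. ennreal ((A \<omega> + (\<Sum>j\<in>J. c j \<omega> * v j \<omega>))\<^sup>2) \<partial>M) =
    (\<integral>\<^sup>+\<omega>. ennreal ((A \<omega>)\<^sup>2) \<partial>M) + (\<Sum>j\<in>J. ennreal (s\<^sup>2) * (\<integral>\<^sup>+\<omega>. ennreal ((v j \<omega>)\<^sup>2) \<partial>M))"
  using assms
proof (induction J rule: finite_induct)
  case empty
  then show ?case by simp
next
  case (insert k J)
  note [measurable] = insert.prems(2)
  have [measurable]: "j \<in> J \<Longrightarrow> c j \<in> borel_measurable M" "j \<in> J \<Longrightarrow> v j \<in> borel_measurable M"
    "c k \<in> borel_measurable M" "v k \<in> borel_measurable M" for j
    using insert.prems(3,4) by auto
  have s: "0 < s" using insert.prems(1)[of k] by (simp add: resampling_def)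
  let ?B = "\<lambda>\<omega>. A \<omega> + (\<Sum>j\<in>J. c j \<omega> * v j \<omega>)"
  have B: "?B (r k \<omega> y) = ?B \<omega>" for \<omega> y
  proof -
    have "c j (r k \<omega> y) = c j \<omega>" "v j (r k \<omega> y) = v j \<omega>" if "j \<in> J" for j
      using insert.prems(7,8)[of k j] insert.hyps(2) that by auto
    then show ?thesis using insert.prems(5)[of k] by simp
  qed
  have eq: "(A \<omega> + (\<Sum>j\<in>insert k J. c j \<omega> * v j \<omega>))\<^sup>2 = (?B \<omega> + c k \<omega> * v k \<omega>)\<^sup>2" for \<omega>
    using insert.hyps by (simp add: algebra_simps)
  have G: "(\<lambda>\<omega>. ennreal ((?B \<omega> + c k \<omega> * v k \<omega>)\<^sup>2)) \<in> borel_measurable M" by measurable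
  have "(\<integral>\<^sup>+\<omega>. ennreal ((A \<omega> + (\<Sum>j\<in>insert k J. c j \<omega> * v j \<omega>))\<^sup>2) \<partial>M) =
      (\<integral>\<^sup>+\<omega>. \<integral>\<^sup>+y. ennreal ((?B (r k \<omega> y) + c k (r k \<omega> y) * v k (r k \<omega> y))\<^sup>2) \<partial>gaussian s \<partial>M)"
    unfolding eq using insert.prems(1)[of k] G unfolding resampling_def by blast
  also have "\<dots> = (\<integral>\<^sup>+\<omega>. \<integral>\<^sup>+y. ennreal ((?B \<omega> + y * v k \<omega>)\<^sup>2) \<partial>gaussian s \<partial>M)"
    unfolding B using insert.prems(6,8)[of k] by simp
  also have "\<dots> = (\<integral>\<^sup>+\<omega>. ennreal ((?B \<omega>)\<^sup>2) + ennreal (s\<^sup>2) * ennreal ((v k \<omega>)\<^sup>2) \<partial>M)"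
    unfolding nn_integral_gaussian_affine_square[OF s] by (simp add: ennreal_mult)
  also have "\<dots> = (\<integral>\<^sup>+\<omega>. ennreal ((?B \<omega>)\<^sup>2) \<partial>M) + ennreal (s\<^sup>2) * (\<integral>\<^sup>+\<omega>. ennreal ((v k \<omega>)\<^sup>2) \<partial>M)"
    by (subst nn_integral_add) (auto simp: nn_integral_cmult)
  also have "(\<integral>\<^sup>+\<omega>. ennreal ((?B \<omega>)\<^sup>2) \<partial>M) =
      (\<integral>\<^sup>+\<omega>. ennreal ((A \<omega>)\<^sup>2) \<partial>M) + (\<Sum>j\<in>J. ennreal (s\<^sup>2) * (\<integral>\<^sup>+\<omega>. ennreal ((v j \<omega>)\<^sup>2) \<partial>M))"
    using insert.prems by (intro insert.IH) auto
  finally show ?case using insert.hyps by (simp add: algebra_simps)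
qed

text \<open>Once coordinate k is split off, overwriting it erases its old value, whose own integral
  has mass one; both sides become the same iterated integral.\<close>

lemma (in gaussian_channel) resampling_prior:
  assumes k: "k \<in> I"
  shows "resampling prior (s k) (\<lambda>t y. t(k := y))"
proof -
  let ?J = "I - {k}"
  have I: "insert k ?J = I" "finite ?J" "k \<notin> ?J" using k fin by auto
  have m[measurable]: "(\<lambda>u. (fst u)(k := snd u)) \<in> prior \<Otimes>\<^sub>M borel \<rightarrow>\<^sub>M TS"
    by (rule measurable_fun_upd[where J=I]) (use k in auto)
  have ins: "(\<integral>\<^sup>+\<omega>. G \<omega> \<partial>prior) = (\<integral>\<^sup>+x. \<integral>\<^sup>+y. G (x(k := y)) \<partial>gaussian (s k) \<partial>PiM ?J (\<lambda>i. gaussian (s i)))"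
    if "G \<in> borel_measurable prior" for G
    using G.product_nn_integral_insert[OF I(2,3), of G] that unfolding I(1) prior_def by simp
  have "(\<integral>\<^sup>+\<omega>. G \<omega> \<partial>prior) = (\<integral>\<^sup>+t. \<integral>\<^sup>+y. G (t(k := y)) \<partial>gaussian (s k) \<partial>prior)"
    if G: "G \<in> borel_measurable prior" for G
  proof -
    have [measurable]: "G \<in> borel_measurable TS" using G by (simp add: measurable_cong_sets[OF sets_prior refl])
    have "(\<lambda>t. \<integral>\<^sup>+y. G (t(k := y)) \<partial>gaussian (s k)) \<in> borel_measurable prior"
    proof -
      have "(\<lambda>u. G ((fst u)(k := snd u))) \<in> borel_measurable (prior \<Otimes>\<^sub>M gaussian (s k))" by measurable
      then show ?thesis 
        by (intro sigma_finite_measure.borel_measurable_nn_integral[OF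
              prob_space_imp_sigma_finite[OF prob_space_gaussian[OF s]]]) (simp add: split_beta')
    qed
    from ins[OF this] show ?thesis
      unfolding ins[OF G] using prob_space.emeasure_space_1[OF prob_space_gaussian[OF s[of k]]] by simp
  qed
  note * = this
  show ?thesis unfolding resampling_def
  proof (intro conjI ballI)
    show "0 < s k" by (rule s)
    show "(\<lambda>u. (fst u)(k := snd u)) \<in> prior \<Otimes>\<^sub>M borel \<rightarrow>\<^sub>M prior"
      using m by (simp add: measurable_cong_sets[OF refl sets_prior])
  qed (erule *)
qed

section \<open>The network at the parameters and at their reproduction\<close>

lemma param_index_iff:
  "(l, i, j) \<in> param_index d N L \<longleftrightarrow> 1 \<le> l \<and> l \<le> L \<and> i < width d N L l \<and> j < width d N L (l - 1)"
  by (simp add: param_index_def)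

lemma finite_param_index: "finite (param_index d N L)"
proof (rule finite_subset)
  let ?W = "{..<d + N + 1}"
  show "param_index d N L \<subseteq> {..L} \<times> ?W \<times> ?W"
    by (auto simp: param_index_def width_def split: if_splits)
qed auto

lemma card_param_index:
  assumes "2 \<le> L"
  shows "card (param_index d N L) = (L - 2) * N\<^sup>2 + N + d * N"
proof -
  let ?S = "\<lambda>l. {l} \<times> ({..<width d N L l} \<times> {..<width d N L (l - 1)})"
  have "param_index d N L = (\<Union>l\<in>{1..L}. ?S l)"
    by (auto simp: param_index_def)
  then have "card (param_index d N L) = (\<Sum>l\<in>{1..L}. card (?S l))"
    by (simp only:) (rule card_UN_disjoint; auto)
  also have "\<dots> = (\<Sum>l\<in>{1..L}. width d N L l * width d N L (l - 1))"
    by (simp add: card_cartesian_product)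
  \<comment> \<open>As L is at least 2, the first and last layers are distinct; they contribute N *
    d and 1 * N weights.\<close>
  also have "{1..L} = insert 1 (insert L {2..<L})" using assms by auto
  also have "(\<Sum>l\<in>insert 1 (insert L {2..<L}). width d N L l * width d N L (l - 1)) =
      N * d + (N + (\<Sum>l\<in>{2..<L}. width d N L l * width d N L (l - 1)))"
    using assms by (simp add: width_def)
  also have "(\<Sum>l\<in>{2..<L}. width d N L l * width d N L (l - 1)) = (\<Sum>l\<in>{2..<L}. N\<^sup>2)"
    by (intro sum.cong) (auto simp: width_def power2_eq_square)
  finally show ?thesis by simp
qed

text \<open>Layer l reads only the weight matrices up to l. This is what makes the weights of a
  layer independent of the values fed into it.\<close>

lemma net_U_upd:
  "l < l' \<Longrightarrow> net_U d N L (\<theta>((l', i', j') := y)) x l = net_U d N L \<theta> x l"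
  by (induction l) (auto simp: fun_eq_iff)

lemma measurable_net_U[measurable]:
  assumes [measurable]: "\<theta> \<in> M \<rightarrow>\<^sub>M PiM (param_index d N L) (\<lambda>_. borel)" "x \<in> M \<rightarrow>\<^sub>M X_space d"
  shows "l \<le> L \<Longrightarrow> i < width d N L l \<Longrightarrow> (\<lambda>w. net_U d N L (\<theta> w) (x w) l i) \<in> borel_measurable M"
proof (induction l arbitrary: i)
  case 0
  then have "i \<in> {..<d}" by (simp add: width_def)
  have x: "x \<in> M \<rightarrow>\<^sub>M PiM {..<d} (\<lambda>_. borel)" using assms(2) by (simp add: X_space_def)
  show ?case using measurable_compose[OF x measurable_component_singleton[OF \<open>i \<in> {..<d}\<close>]] by simp
next
  case (Suc l)
  have 1: "(\<lambda>w. net_U d N L (\<theta> w) (x w) l j) \<in> borel_measurable M" if "j < width d N L l" for j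
    using Suc that by auto
  have 2: "(\<lambda>w. \<theta> w (Suc l, i, j)) \<in> borel_measurable M" if "j < width d N L l" for j
    using measurable_compose[OF assms(1) measurable_component_singleton[of "(Suc l, i, j)"]] Suc.prems that
    by (simp add: param_index_iff)
  show ?case using 1 2 by (auto intro!: borel_measurable_max borel_measurable_sum borel_measurable_times)
qed

lemma relu_contraction: "(max 0 a - max 0 b)\<^sup>2 \<le> (a - b :: real)\<^sup>2"
  by (rule abs_le_square_iff[THEN iffD1]) (auto simp: max_def)

section \<open>Propagation of the mean squared error through the layers\<close>

locale dnn =
  fixes d N L :: nat and \<delta> :: real
  assumes dims: "1 \<le> d" "1 \<le> N" and \<delta>01: "0 < \<delta>" "\<delta> < 1"
begin

sublocale gaussian_channel "param_index d N L" "weight_sd d N" \<delta>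
  by unfold_locales (use dims \<delta>01 in \<open>auto simp: finite_param_index weight_sd_def split: prod.splits\<close>)

sublocale X: gaussian_channel "{..<d}" "\<lambda>_. 1" \<delta>
  by unfold_locales (use \<delta>01 in auto)

lemma X_law: "X_law d = X.prior"
  by (simp add: X_law_def X.prior_def)

lemma X_space: "X_space d = X.TS"
  by (simp add: X_space_def)

lemma sets_X_space[measurable_cong]: "sets (X_space d) = sets X.TS"
  by (simp add: X_space)

lemma Theta_prior: "Theta_prior d N L = prior"
  by (simp add: Theta_prior_def prior_def)

lemma Theta_space: "Theta_space d N L = TS"
  by (simp add: Theta_space_def)

text \<open>Sample points are \<open>((t, x), z)\<close>: the reproduction, the input and the channel noise.\<close>
definition "Om = (prior \<Otimes>\<^sub>M X.prior) \<Otimes>\<^sub>M prior"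

sublocale PX: pair_prob_space prior X.prior ..
sublocale Om: pair_prob_space "prior \<Otimes>\<^sub>M X.prior" prior ..

lemma sets_Om[measurable_cong]: "sets Om = sets ((TS \<Otimes>\<^sub>M X_space d) \<Otimes>\<^sub>M TS)"
  unfolding Om_def by (intro sets_pair_measure_cong) (auto simp: X_space)

definition "t \<omega> = fst (fst \<omega>)" for \<omega> :: "(params \<times> (nat \<Rightarrow> real)) \<times> params"
definition "x \<omega> = snd (fst \<omega>)" for \<omega> :: "(params \<times> (nat \<Rightarrow> real)) \<times> params"
definition "z \<omega> = snd \<omega>" for \<omega> :: "(params \<times> (nat \<Rightarrow> real)) \<times> params"

lemma measurable_txz[measurable]: "t \<in> Om \<rightarrow>\<^sub>M TS" "x \<in> Om \<rightarrow>\<^sub>M X_space d" "z \<in> Om \<rightarrow>\<^sub>M TS"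
  unfolding t_def x_def z_def by measurable

text \<open>\<open>U\<close> is the network at the true weights in the reversed description,
  \<open>V\<close> the network at their posterior mean given t.\<close>

definition "U l i \<omega> = net_U d N L (mix (t \<omega>) (z \<omega>)) (x \<omega>) l i"
definition "V l i \<omega> = net_U d N L (chan (sqrt (1 - \<delta>)) 0 (t \<omega>) (t \<omega>)) (x \<omega>) l i"

lemma measurable_UV[measurable]:
  assumes "l \<le> L" "i < width d N L l"
  shows "U l i \<in> borel_measurable Om" "V l i \<in> borel_measurable Om"
  unfolding U_def[abs_def] V_def[abs_def] using assms by measurable

definition "rt k \<omega> y = (((t \<omega>)(k := y), x \<omega>), z \<omega>)"
definition "rz k \<omega> y = ((t \<omega>, x \<omega>), (z \<omega>)(k := y))"

lemma resampling_rt: "k \<in> param_index d N L \<Longrightarrow> resampling Om (weight_sd d N k) (rt k)"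
  using resampling_fst[OF PX.prob_space_axioms prior.prob_space_axioms
      resampling_fst[OF prior.prob_space_axioms X.prior.prob_space_axioms resampling_prior[of k]]]
  by (simp add: Om_def rt_def[abs_def] t_def x_def z_def)

lemma resampling_rz: "k \<in> param_index d N L \<Longrightarrow> resampling Om (weight_sd d N k) (rz k)"
  using resampling_snd[OF PX.prob_space_axioms prior.prob_space_axioms resampling_prior[of k]]
  by (simp add: Om_def rz_def[abs_def] t_def x_def z_def)

lemma txz_resample[simp]:
  "t (rt k \<omega> y) = (t \<omega>)(k := y)" "x (rt k \<omega> y) = x \<omega>" "z (rt k \<omega> y) = z \<omega>"
  "t (rz k \<omega> y) = t \<omega>" "x (rz k \<omega> y) = x \<omega>" "z (rz k \<omega> y) = (z \<omega>)(k := y)"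
  by (simp_all add: rt_def rz_def t_def x_def z_def)

lemma chan_upd:
  assumes "k \<in> param_index d N L"
  shows "chan r q (a(k := y)) b = (chan r q a b)(k := r * y + q * b k)"
    and "chan r q a (b(k := y)) = (chan r q a b)(k := r * a k + q * y)"
  using assms by (auto simp: chan_def fun_eq_iff)

lemma UV_resample:
  assumes "k \<in> param_index d N L" "k = (l', i', j')" "l < l'"
  shows "U l i (rt k \<omega> y) = U l i \<omega>" "U l i (rz k \<omega> y) = U l i \<omega>"
    "V l i (rt k \<omega> y) = V l i \<omega>" "V l i (rz k \<omega> y) = V l i \<omega>"
  using assms(1,3) unfolding U_def V_def assms(2) by (simp_all add: chan_upd net_U_upd)

text \<open>\<open>second_moment_sum\<close> is applied twice: to the entries of t with the whole
  z-sum as remainder, then to the entries of z with remainder 0. Hence \<beta> has to be invariant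
  under both resamplings, and \<alpha> under that of t.\<close>

lemma row_second_moment:
  fixes \<alpha> \<beta> :: "nat \<Rightarrow> (params \<times> (nat \<Rightarrow> real)) \<times> params \<Rightarrow> real"
  assumes l: "l < L" and i: "i < width d N L (Suc l)"
    and [measurable]: "\<And>j. j < width d N L l \<Longrightarrow> \<alpha> j \<in> borel_measurable Om"
      "\<And>j. j < width d N L l \<Longrightarrow> \<beta> j \<in> borel_measurable Om"
    and inv: "\<And>j j' \<omega> y. j < width d N L l \<Longrightarrow> j' < width d N L l \<Longrightarrow> \<alpha> j (rt (Suc l, i, j') \<omega> y) = \<alpha> j \<omega>"
      "\<And>j j' \<omega> y. j < width d N L l \<Longrightarrow> j' < width d N L l \<Longrightarrow> \<beta> j (rt (Suc l, i, j') \<omega> y) = \<beta> j \<omega>"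
      "\<And>j j' \<omega> y. j < width d N L l \<Longrightarrow> j' < width d N L l \<Longrightarrow> \<beta> j (rz (Suc l, i, j') \<omega> y) = \<beta> j \<omega>"
    and a: "\<And>j. j < width d N L l \<Longrightarrow> (\<integral>\<^sup>+\<omega>. ennreal ((\<alpha> j \<omega>)\<^sup>2) \<partial>Om) \<le> ennreal a" "0 \<le> a"
    and b: "\<And>j. j < width d N L l \<Longrightarrow> (\<integral>\<^sup>+\<omega>. ennreal ((\<beta> j \<omega>)\<^sup>2) \<partial>Om) \<le> ennreal b" "0 \<le> b"
  shows "(\<integral>\<^sup>+\<omega>. ennreal ((\<Sum>j<width d N L l. t \<omega> (Suc l, i, j) * \<alpha> j \<omega> + z \<omega> (Suc l, i, j) * \<beta> j \<omega>)\<^sup>2) \<partial>Om)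
    \<le> ennreal (a + b)"
proof -
  let ?n = "width d N L l" and ?k = "\<lambda>j. (Suc l, i, j)"
  define s where "s = weight_sd d N (Suc l, i, 0)"
  have s: "weight_sd d N (?k j) = s" for j by (simp add: s_def weight_sd_def)
  \<comment> \<open>Fan-in times weight variance is one: d * (1 / d) in the first layer and N * (1 /
    N) above it, where l < L ensures that layer l has width N.\<close>
  have n: "real ?n * s\<^sup>2 = 1"
    using dims l by (auto simp: s_def weight_sd_def width_def power_divide)
  have k: "?k j \<in> param_index d N L" if "j < ?n" for j
    using l i that by (simp add: param_index_iff)
  have [measurable]: "(\<lambda>\<omega>. t \<omega> (?k j)) \<in> borel_measurable Om" "(\<lambda>\<omega>. z \<omega> (?k j)) \<in> borel_measurable Om"
    if "j < ?n" for j
    using k[OF that] by measurable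
  let ?B = "\<lambda>\<omega>. \<Sum>j<?n. z \<omega> (?k j) * \<beta> j \<omega>"
  have "(\<integral>\<^sup>+\<omega>. ennreal ((\<Sum>j<?n. t \<omega> (?k j) * \<alpha> j \<omega> + z \<omega> (?k j) * \<beta> j \<omega>)\<^sup>2) \<partial>Om) =
      (\<integral>\<^sup>+\<omega>. ennreal ((?B \<omega> + (\<Sum>j<?n. t \<omega> (?k j) * \<alpha> j \<omega>))\<^sup>2) \<partial>Om)"
    by (simp add: sum.distrib add.commute)
  also have "\<dots> = (\<integral>\<^sup>+\<omega>. ennreal ((?B \<omega>)\<^sup>2) \<partial>Om) + (\<Sum>j<?n. ennreal (s\<^sup>2) * (\<integral>\<^sup>+\<omega>. ennreal ((\<alpha> j \<omega>)\<^sup>2) \<partial>Om))"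
    using resampling_rt[OF k] unfolding s
    by (intro second_moment_sum[where r="\<lambda>j. rt (?k j)"]) (auto simp: inv intro!: sum.cong)
  also have "(\<integral>\<^sup>+\<omega>. ennreal ((?B \<omega>)\<^sup>2) \<partial>Om) = (\<integral>\<^sup>+\<omega>. ennreal ((0 + ?B \<omega>)\<^sup>2) \<partial>Om)" by simp
  also have "\<dots> = (\<integral>\<^sup>+\<omega>. ennreal (0\<^sup>2) \<partial>Om) + (\<Sum>j<?n. ennreal (s\<^sup>2) * (\<integral>\<^sup>+\<omega>. ennreal ((\<beta> j \<omega>)\<^sup>2) \<partial>Om))"
    using resampling_rz[OF k] unfolding s
    by (intro second_moment_sum[where r="\<lambda>j. rz (?k j)"]) (auto simp: inv)
  also have "\<dots> = (\<Sum>j<?n. ennreal (s\<^sup>2) * (\<integral>\<^sup>+\<omega>. ennreal ((\<beta> j \<omega>)\<^sup>2) \<partial>Om))" by simp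
  also have "\<dots> + (\<Sum>j<?n. ennreal (s\<^sup>2) * (\<integral>\<^sup>+\<omega>. ennreal ((\<alpha> j \<omega>)\<^sup>2) \<partial>Om))
      \<le> (\<Sum>j<?n. ennreal (s\<^sup>2) * ennreal b) + (\<Sum>j<?n. ennreal (s\<^sup>2) * ennreal a)"
    by (intro add_mono sum_mono mult_left_mono a b) auto
  also have "\<dots> = ennreal (real ?n * s\<^sup>2 * b + real ?n * s\<^sup>2 * a)"
    using a(2) b(2) by (simp add: ennreal_mult'[symmetric] ennreal_of_nat_eq_real_of_nat mult.assoc)
  also have "\<dots> = ennreal (a + b)" unfolding n by (simp add: add.commute)
  finally show ?thesis .
qed

lemma nn_integral_scaled_square_le:
  assumes [measurable]: "f \<in> borel_measurable M" and "(\<integral>\<^sup>+\<omega>. ennreal ((f \<omega>)\<^sup>2) \<partial>M) \<le> ennreal a" "0 \<le> a"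
  shows "(\<integral>\<^sup>+\<omega>. ennreal ((c * f \<omega>)\<^sup>2) \<partial>M) \<le> ennreal (c\<^sup>2 * a)"
proof -
  have "(\<integral>\<^sup>+\<omega>. ennreal ((c * f \<omega>)\<^sup>2) \<partial>M) = ennreal (c\<^sup>2) * (\<integral>\<^sup>+\<omega>. ennreal ((f \<omega>)\<^sup>2) \<partial>M)"
    by (simp add: power_mult_distrib ennreal_mult nn_integral_cmult)
  also have "\<dots> \<le> ennreal (c\<^sup>2) * ennreal a" by (intro mult_left_mono assms) auto
  finally show ?thesis using assms(3) by (simp add: ennreal_mult)
qed

text \<open>Both inputs of the row estimate are multiples of the previous layer, with squared
  factors 1 - \<delta> and \<delta> that add up to one; ReLU does not increase the square.\<close>

lemma U_second_moment:
  "l \<le> L \<Longrightarrow> i < width d N L l \<Longrightarrow> (\<integral>\<^sup>+\<omega>. ennreal ((U l i \<omega>)\<^sup>2) \<partial>Om) \<le> ennreal 1"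
proof (induction l arbitrary: i)
  case 0
  then have i: "i \<in> {..<d}" by (simp add: width_def)
  note c = X.prior_component(3,4)[OF i]
  have 1: "integrable Om (\<lambda>\<omega>. (x \<omega> i)\<^sup>2)" "(\<integral>\<omega>. (x \<omega> i)\<^sup>2 \<partial>Om) = 1"
    unfolding Om_def x_def
    using Om.integral_fst_only[OF PX.integral_snd_only(1)[OF c(1)]] PX.integral_snd_only(2)[OF c(1)] c(2)
    by simp_all
  have "(\<integral>\<^sup>+\<omega>. ennreal ((U 0 i \<omega>)\<^sup>2) \<partial>Om) = ennreal (\<integral>\<omega>. (x \<omega> i)\<^sup>2 \<partial>Om)"
    unfolding U_def by (simp add: nn_integral_eq_integral[OF 1(1)])
  then show ?case using 1(2) by simp
next
  case (Suc l)
  let ?n = "width d N L l" and ?k = "\<lambda>j. (Suc l, i, j)"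
  let ?\<alpha> = "\<lambda>j \<omega>. sqrt (1 - \<delta>) * U l j \<omega>" and ?\<beta> = "\<lambda>j \<omega>. sqrt \<delta> * U l j \<omega>"
  have k: "?k j \<in> param_index d N L" if "j < ?n" for j
    using Suc.prems that by (simp add: param_index_iff)
  have m: "U l j \<in> borel_measurable Om" if "j < ?n" for j
    using Suc.prems that by simp
  have le: "(U (Suc l) i \<omega>)\<^sup>2 \<le> (\<Sum>j<?n. t \<omega> (?k j) * ?\<alpha> j \<omega> + z \<omega> (?k j) * ?\<beta> j \<omega>)\<^sup>2" for \<omega>
  proof -
    have "U (Suc l) i \<omega> = max 0 (\<Sum>j<?n. t \<omega> (?k j) * ?\<alpha> j \<omega> + z \<omega> (?k j) * ?\<beta> j \<omega>)"
      unfolding U_def net_U.simps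
      by (intro arg_cong2[where f=max] sum.cong refl) (use k in \<open>simp add: chan_def algebra_simps\<close>)
    then show ?thesis using relu_contraction[of _ 0] by simp
  qed
  have ih: "(\<integral>\<^sup>+\<omega>. ennreal ((U l j \<omega>)\<^sup>2) \<partial>Om) \<le> ennreal 1" if "j < ?n" for j
    using Suc that by simp
  have "(\<integral>\<^sup>+\<omega>. ennreal ((U (Suc l) i \<omega>)\<^sup>2) \<partial>Om) \<le>
      (\<integral>\<^sup>+\<omega>. ennreal ((\<Sum>j<?n. t \<omega> (?k j) * ?\<alpha> j \<omega> + z \<omega> (?k j) * ?\<beta> j \<omega>)\<^sup>2) \<partial>Om)"
    by (intro nn_integral_mono ennreal_leI le)
  also have "\<dots> \<le> ennreal ((sqrt (1 - \<delta>))\<^sup>2 * 1 + (sqrt \<delta>)\<^sup>2 * 1)"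
    using Suc.prems \<delta>01
    by (intro row_second_moment nn_integral_scaled_square_le ih)
       (auto simp: UV_resample[OF k] intro!: borel_measurable_times m)
  also have "\<dots> = ennreal 1" using \<delta>01 by simp
  finally show ?case .
qed

text \<open>With \<open>\<theta> = sqrt (1 - \<delta>) t + sqrt \<delta> z\<close>, the two preactivations differ by
  \<open>\<Sum>j. sqrt (1 - \<delta>) t\<^sub>j (U\<^sub>j - V\<^sub>j) + sqrt \<delta> z\<^sub>j U\<^sub>j\<close>, whose summands are orthogonal; so each layer
  turns a mean squared error \<open>e\<close> into at most \<open>(1 - \<delta>) e + \<delta>\<close>.\<close>
lemma UV_distance:
  "l \<le> L \<Longrightarrow> i < width d N L l \<Longrightarrow> (\<integral>\<^sup>+\<omega>. ennreal ((U l i \<omega> - V l i \<omega>)\<^sup>2) \<partial>Om) \<le> ennreal (real l * \<delta>)"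
proof (induction l arbitrary: i)
  case 0
  then show ?case by (simp add: U_def V_def)
next
  case (Suc l)
  let ?n = "width d N L l" and ?k = "\<lambda>j. (Suc l, i, j)"
  let ?\<alpha> = "\<lambda>j \<omega>. sqrt (1 - \<delta>) * (U l j \<omega> - V l j \<omega>)" and ?\<beta> = "\<lambda>j \<omega>. sqrt \<delta> * U l j \<omega>"
  have k: "?k j \<in> param_index d N L" if "j < ?n" for j
    using Suc.prems that by (simp add: param_index_iff)
  have m: "U l j \<in> borel_measurable Om" "V l j \<in> borel_measurable Om" if "j < ?n" for j
    using Suc.prems that by simp_all
  have le: "(U (Suc l) i \<omega> - V (Suc l) i \<omega>)\<^sup>2 \<le> (\<Sum>j<?n. t \<omega> (?k j) * ?\<alpha> j \<omega> + z \<omega> (?k j) * ?\<beta> j \<omega>)\<^sup>2" for \<omega>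
  proof -
    have "(\<Sum>j<?n. mix (t \<omega>) (z \<omega>) (?k j) * U l j \<omega>) - (\<Sum>j<?n. chan (sqrt (1 - \<delta>)) 0 (t \<omega>) (t \<omega>) (?k j) * V l j \<omega>)
      = (\<Sum>j<?n. t \<omega> (?k j) * ?\<alpha> j \<omega> + z \<omega> (?k j) * ?\<beta> j \<omega>)"
      unfolding sum_subtractf[symmetric]
      by (intro sum.cong refl) (use k in \<open>simp add: chan_def algebra_simps\<close>)
    then show ?thesis
      using relu_contraction[of "\<Sum>j<?n. mix (t \<omega>) (z \<omega>) (?k j) * U l j \<omega>"
          "\<Sum>j<?n. chan (sqrt (1 - \<delta>)) 0 (t \<omega>) (t \<omega>) (?k j) * V l j \<omega>"]
      by (simp add: U_def V_def)
  qed
  have ih: "(\<integral>\<^sup>+\<omega>. ennreal ((U l j \<omega> - V l j \<omega>)\<^sup>2) \<partial>Om) \<le> ennreal (real l * \<delta>)"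
    "(\<integral>\<^sup>+\<omega>. ennreal ((U l j \<omega>)\<^sup>2) \<partial>Om) \<le> ennreal 1" if "j < ?n" for j
    using Suc that U_second_moment[of l j] by simp_all
  have "(\<integral>\<^sup>+\<omega>. ennreal ((U (Suc l) i \<omega> - V (Suc l) i \<omega>)\<^sup>2) \<partial>Om) \<le>
      (\<integral>\<^sup>+\<omega>. ennreal ((\<Sum>j<?n. t \<omega> (?k j) * ?\<alpha> j \<omega> + z \<omega> (?k j) * ?\<beta> j \<omega>)\<^sup>2) \<partial>Om)"
    by (intro nn_integral_mono ennreal_leI le)
  also have "\<dots> \<le> ennreal ((sqrt (1 - \<delta>))\<^sup>2 * (real l * \<delta>) + (sqrt \<delta>)\<^sup>2 * 1)"
    using Suc.prems \<delta>01
    by (intro row_second_moment nn_integral_scaled_square_le ih)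
       (auto simp: UV_resample[OF k] intro!: borel_measurable_times borel_measurable_diff m)
  also have "\<dots> \<le> ennreal (real (Suc l) * \<delta>)"
  proof (rule ennreal_leI)
    \<comment> \<open>Dropping the factor 1 - \<delta> on the inherited error makes the recursion
      linear: every layer adds \<delta>.\<close>
    have "(1 - \<delta>) * (real l * \<delta>) \<le> 1 * (real l * \<delta>)" using \<delta>01 by (intro mult_right_mono) auto
    then show "(sqrt (1 - \<delta>))\<^sup>2 * (real l * \<delta>) + (sqrt \<delta>)\<^sup>2 * 1 \<le> real (Suc l) * \<delta>"
      using \<delta>01 by (simp add: algebra_simps)
  qed
  finally show ?case .
qed

end

section \<open>The rate-distortion bound\<close>

lemma distr_eqI_nn_integral:
  assumes [measurable]: "f \<in> M \<rightarrow>\<^sub>M N" "g \<in> M' \<rightarrow>\<^sub>M N"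
    and eq: "\<And>G. G \<in> borel_measurable N \<Longrightarrow> (\<integral>\<^sup>+w. G (f w) \<partial>M) = (\<integral>\<^sup>+w. G (g w) \<partial>M')"
  shows "distr M N f = distr M' N g"
proof (rule measure_eqI)
  fix B assume "B \<in> sets (distr M N f)"
  then have B[measurable]: "B \<in> sets N" by simp
  have "emeasure (distr M N f) B = (\<integral>\<^sup>+v. indicator B v \<partial>distr M N f)" by simp
  also have "\<dots> = (\<integral>\<^sup>+w. indicator B (f w) \<partial>M)" by (rule nn_integral_distr) measurable
  also have "\<dots> = (\<integral>\<^sup>+w. indicator B (g w) \<partial>M')" by (rule eq) measurable
  also have "\<dots> = (\<integral>\<^sup>+v. indicator B v \<partial>distr M' N g)" by (rule nn_integral_distr[symmetric]) measurable
  also have "\<dots> = emeasure (distr M' N g) B" by simp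
  finally show "emeasure (distr M N f) B = emeasure (distr M' N g) B" .
qed simp

lemma distr_fst_cong:
  assumes [measurable]: "f \<in> M \<rightarrow>\<^sub>M N" "h \<in> M \<rightarrow>\<^sub>M K" "g \<in> M' \<rightarrow>\<^sub>M N" "k \<in> M' \<rightarrow>\<^sub>M K"
    and law: "distr M (N \<Otimes>\<^sub>M K) (\<lambda>w. (f w, h w)) = distr M' (N \<Otimes>\<^sub>M K) (\<lambda>w. (g w, k w))"
  shows "distr M N f = distr M' N g"
proof -
  have "distr (distr M (N \<Otimes>\<^sub>M K) (\<lambda>w. (f w, h w))) N fst = distr M N f"
    "distr (distr M' (N \<Otimes>\<^sub>M K) (\<lambda>w. (g w, k w))) N fst = distr M' N g"
    by (simp_all add: distr_distr comp_def)
  then show ?thesis using law by simp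
qed

section \<open>The test channel as a Markov kernel\<close>

context gaussian_channel
begin

definition "K \<theta> = distr prior TS (mix \<theta>)"

lemma K_measurable: "K \<in> TS \<rightarrow>\<^sub>M prob_algebra TS"
proof -
  have "(\<lambda>\<theta>. distr prior TS (mix \<theta>)) \<in> TS \<rightarrow>\<^sub>M prob_algebra TS"
  proof (rule measurable_distr_prob_space2[where M=TS])
    show "(\<lambda>\<theta>. prior) \<in> TS \<rightarrow>\<^sub>M prob_algebra TS"
      by (rule measurable_const) (simp add: space_prob_algebra prior.prob_space_axioms)
    show "(\<lambda>(\<theta>, b). mix \<theta> b) \<in> TS \<Otimes>\<^sub>M TS \<rightarrow>\<^sub>M TS" by measurable
  qed
  then show ?thesis by (simp add: K_def[abs_def])
qed

text \<open>Identifies the law that \<open>joint_law\<close> builds from a kernel with the explicit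
  image measure, for which density and reversal are available.\<close>

lemma bind_K: "prior \<bind> (\<lambda>\<theta>. distr (K \<theta>) (TS \<Otimes>\<^sub>M TS) (\<lambda>a. (\<theta>, a))) = joint"
proof -
  let ?Q = "\<lambda>\<theta>. distr (K \<theta>) (TS \<Otimes>\<^sub>M TS) (\<lambda>a. (\<theta>, a))"
  have Q: "?Q \<in> TS \<rightarrow>\<^sub>M prob_algebra (TS \<Otimes>\<^sub>M TS)"
    by (rule measurable_distr_prob_space2[OF K_measurable]) measurable
  have Q': "?Q \<in> prior \<rightarrow>\<^sub>M subprob_algebra (TS \<Otimes>\<^sub>M TS)"
    using measurable_prob_algebraD[OF Q] by (simp add: measurable_cong_sets[OF sets_prior refl])
  show ?thesis
  proof (rule measure_eqI)
    show sets: "sets (prior \<bind> ?Q) = sets joint"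
      using sets_bind_measurable[OF Q' prior.not_empty] by simp
    fix B assume "B \<in> sets (prior \<bind> ?Q)"
    then have B[measurable]: "B \<in> sets (TS \<Otimes>\<^sub>M TS)" unfolding sets by simp
    have "emeasure (prior \<bind> ?Q) B = (\<integral>\<^sup>+u. indicator B u \<partial>(prior \<bind> ?Q))"
      by (rule nn_integral_indicator[symmetric]) (simp add: sets)
    also have "\<dots> = (\<integral>\<^sup>+\<theta>. \<integral>\<^sup>+u. indicator B u \<partial>?Q \<theta> \<partial>prior)"
      by (rule nn_integral_bind[OF _ Q']) measurable
    also have "\<dots> = (\<integral>\<^sup>+\<theta>. \<integral>\<^sup>+b. indicator B (\<theta>, mix \<theta> b) \<partial>prior \<partial>prior)"
    proof (rule nn_integral_cong)
      fix \<theta> assume "\<theta> \<in> space prior"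
      then have \<theta>: "\<theta> \<in> space TS" by (simp only: space_prior_TS)
      have m1: "mix \<theta> \<in> prior \<rightarrow>\<^sub>M TS"
        by (rule measurable_chan[OF measurable_const[OF \<theta>] measurable_ident_sets[OF sets_prior]])
      have m2: "Pair \<theta> \<in> TS \<rightarrow>\<^sub>M TS \<Otimes>\<^sub>M TS" by (rule measurable_Pair1'[OF \<theta>])
      have "?Q \<theta> = distr prior (TS \<Otimes>\<^sub>M TS) (\<lambda>b. (\<theta>, mix \<theta> b))"
        unfolding K_def using distr_distr[OF m2 m1] by (simp add: comp_def)
      then show "(\<integral>\<^sup>+u. indicator B u \<partial>?Q \<theta>) = (\<integral>\<^sup>+b. indicator B (\<theta>, mix \<theta> b) \<partial>prior)"
        using nn_integral_distr[OF measurable_compose[OF m1 m2], of "indicator B"] by simp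
    qed
    also have "\<dots> = (\<integral>\<^sup>+u. indicator B u \<partial>joint)"
      by (rule nn_integral_joint[symmetric]) measurable
    also have "\<dots> = emeasure joint B" by simp
    finally show "emeasure (prior \<bind> ?Q) B = emeasure joint B" .
  qed
qed

end

section \<open>Two observation models of the network and their comparison\<close>

locale noisy_dnn = dnn +
  fixes s2 :: real
  assumes s2: "0 < s2" and L: "1 \<le> L"
begin

definition "JX = joint \<Otimes>\<^sub>M X.prior"
definition "JL = JX \<Otimes>\<^sub>M gaussian (sqrt s2)"

lemma joint_law_K: "joint_law d N L s2 K = JL"
  unfolding joint_law_def JL_def JX_def Theta_prior Theta_space X_law bind_K ..

sublocale JX: pair_prob_space joint X.prior ..

sublocale W: prob_space "gaussian (sqrt s2)"
  by (rule prob_space_gaussian) (simp add: s2)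

sublocale JXp: prob_space JX unfolding JX_def by (rule JX.prob_space_axioms)

sublocale JL: pair_prob_space JX "gaussian (sqrt s2)" ..

sublocale JLp: prob_space JL unfolding JL_def by (rule JL.prob_space_axioms)

lemma sets_JX[measurable_cong]: "sets JX = sets ((TS \<Otimes>\<^sub>M TS) \<Otimes>\<^sub>M X_space d)"
  unfolding JX_def by (intro sets_pair_measure_cong) (auto simp: X_space)

lemma sets_JL[measurable_cong]: "sets JL = sets (((TS \<Otimes>\<^sub>M TS) \<Otimes>\<^sub>M X_space d) \<Otimes>\<^sub>M borel)"
  unfolding JL_def by (intro sets_pair_measure_cong) (auto simp: sets_JX)

lemma measurable_net_out[measurable]:
  assumes [measurable]: "f \<in> M \<rightarrow>\<^sub>M TS" "g \<in> M \<rightarrow>\<^sub>M X_space d"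
  shows "(\<lambda>w. net_out d N L (f w) (g w)) \<in> borel_measurable M"
  unfolding net_out_def by (rule measurable_net_U) (use L in \<open>auto simp: width_def\<close>)

lemma MI_channel:
  "MI JL TS TS (\<lambda>w. fst (fst (fst w))) (\<lambda>w. snd (fst (fst w))) =
    ennreal (real (card (param_index d N L)) / 2 * ln (1 / \<delta>))"
proof (rule MI_joint)
  have "distr JL (TS \<Otimes>\<^sub>M TS) (\<lambda>w. fst (fst w)) = distr (distr JL JX fst) joint fst"
    by (subst distr_distr) (auto simp: JX_def JL_def comp_def intro!: distr_cong)
  also have "\<dots> = joint"
    unfolding JL_def W.distr_pair_fst unfolding JX_def X.prior.distr_pair_fst ..
  finally show "distr JL (TS \<Otimes>\<^sub>M TS) (\<lambda>w. (fst (fst (fst w)), snd (fst (fst w)))) = joint" by simp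
qed (rule JLp.prob_space_axioms, measurable)

text \<open>The point where the reversal enters: expectations under the forward channel law become
  expectations over independent t, x and z.\<close>

lemma nn_integral_JX:
  assumes [measurable]: "G \<in> borel_measurable ((TS \<Otimes>\<^sub>M TS) \<Otimes>\<^sub>M X_space d)"
  shows "(\<integral>\<^sup>+u. G u \<partial>JX) = (\<integral>\<^sup>+\<omega>. G ((mix (t \<omega>) (z \<omega>), t \<omega>), x \<omega>) \<partial>Om)"
proof -
  interpret s: pair_sigma_finite X.prior prior ..
  have "(\<integral>\<^sup>+u. G u \<partial>JX) = (\<integral>\<^sup>+v. \<integral>\<^sup>+a. G (v, a) \<partial>X.prior \<partial>joint)"
    unfolding JX_def by (rule X.prior.nn_integral_fst[symmetric]) measurable
  also have "\<dots> = (\<integral>\<^sup>+\<theta>. \<integral>\<^sup>+b. (\<integral>\<^sup>+a. G ((\<theta>, mix \<theta> b), a) \<partial>X.prior) \<partial>prior \<partial>prior)"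
    by (rule nn_integral_joint) measurable
  also have "\<dots> = (\<integral>\<^sup>+\<theta>. \<integral>\<^sup>+b. (\<integral>\<^sup>+a. G ((mix \<theta> b, \<theta>), a) \<partial>X.prior) \<partial>prior \<partial>prior)"
    by (rule nn_integral_chan_reverse) measurable
  also have "\<dots> = (\<integral>\<^sup>+\<theta>. \<integral>\<^sup>+a. \<integral>\<^sup>+b. G ((mix \<theta> b, \<theta>), a) \<partial>prior \<partial>X.prior \<partial>prior)"
  proof (rule nn_integral_cong)
    fix \<theta> assume "\<theta> \<in> space prior"
    then have [measurable]: "\<theta> \<in> space TS" by (simp only: space_prior_TS)
    show "(\<integral>\<^sup>+b. \<integral>\<^sup>+a. G ((mix \<theta> b, \<theta>), a) \<partial>X.prior \<partial>prior) = (\<integral>\<^sup>+a. \<integral>\<^sup>+b. G ((mix \<theta> b, \<theta>), a) \<partial>prior \<partial>X.prior)"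
      by (rule s.Fubini') measurable
  qed
  also have "\<dots> = (\<integral>\<^sup>+u. \<integral>\<^sup>+b. G ((mix (fst u) b, fst u), snd u) \<partial>prior \<partial>(prior \<Otimes>\<^sub>M X.prior))"
    by (subst X.prior.nn_integral_fst[symmetric]) simp_all
  also have "\<dots> = (\<integral>\<^sup>+\<omega>. G ((mix (t \<omega>) (z \<omega>), t \<omega>), x \<omega>) \<partial>Om)"
    unfolding Om_def t_def x_def z_def by (subst prior.nn_integral_fst[symmetric]) simp_all
  finally show ?thesis .
qed

text \<open>Regroups the variables as (\<theta>, (t, x)), the nesting in which \<open>condMI\<close>
  pairs its second variable with the conditioning one.\<close>

definition "R1 = distr JX (TS \<Otimes>\<^sub>M (TS \<Otimes>\<^sub>M X_space d)) (\<lambda>u. (fst (fst u), (snd (fst u), snd u)))"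

lemma sets_R1[simp, measurable_cong]: "sets R1 = sets (TS \<Otimes>\<^sub>M (TS \<Otimes>\<^sub>M X_space d))"
  by (simp add: R1_def)

sublocale R1p: prob_space R1
  unfolding R1_def by (rule JXp.prob_space_distr) measurable

lemma nn_integral_R1:
  assumes [measurable]: "G \<in> borel_measurable (TS \<Otimes>\<^sub>M (TS \<Otimes>\<^sub>M X_space d))"
  shows "(\<integral>\<^sup>+v. G v \<partial>R1) = (\<integral>\<^sup>+u. G (fst (fst u), (snd (fst u), snd u)) \<partial>JX)"
  unfolding R1_def by (rule nn_integral_distr) measurable

text \<open>Everything that determines the network output is observed, so
  \<open>ln_post_noiseless\<close> applies; a copy of the prior fills the hidden slot.\<close>

sublocale full: additive_noise R1 prior "\<lambda>u. net_out d N L (fst (fst u)) (snd (snd (fst u)))" "sqrt s2"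
proof
  have "(\<integral>\<^sup>+u. ennreal ((net_out d N L (fst (fst u)) (snd (snd (fst u))))\<^sup>2) \<partial>(R1 \<Otimes>\<^sub>M prior)) =
      (\<integral>\<^sup>+v. ennreal ((net_out d N L (fst v) (snd (snd v)))\<^sup>2) \<partial>R1)"
    using prior.emeasure_space_1 by (subst prior.nn_integral_fst[symmetric]) simp_all
  also have "\<dots> = (\<integral>\<^sup>+u. ennreal ((net_out d N L (fst (fst u)) (snd u))\<^sup>2) \<partial>JX)"
    by (subst nn_integral_R1) simp_all
  also have "\<dots> = (\<integral>\<^sup>+\<omega>. ennreal ((U L 0 \<omega>)\<^sup>2) \<partial>Om)"
    by (subst nn_integral_JX) (simp_all add: U_def net_out_def[symmetric])
  also have "\<dots> \<le> ennreal 1" using L by (intro U_second_moment) (auto simp: width_def)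
  also have "\<dots> < \<infinity>" by simp
  finally show "(\<integral>\<^sup>+u. ennreal ((net_out d N L (fst (fst u)) (snd (snd (fst u))))\<^sup>2) \<partial>(R1 \<Otimes>\<^sub>M prior)) < \<infinity>" .
qed (use s2 in \<open>measurable\<close>, use s2 in simp)

text \<open>Only (t, x) is observed. In the reversed description the hidden z is independent of it,
  as the locale demands.\<close>

sublocale part: additive_noise "prior \<Otimes>\<^sub>M X.prior" prior "U L 0" "sqrt s2"
proof
  have 0: "0 < width d N L L" using L by (simp add: width_def)
  show "U L 0 \<in> borel_measurable ((prior \<Otimes>\<^sub>M X.prior) \<Otimes>\<^sub>M prior)"
    using measurable_UV(1)[OF order_refl 0] by (simp add: Om_def)
  show "(\<integral>\<^sup>+u. ennreal ((U L 0 u)\<^sup>2) \<partial>((prior \<Otimes>\<^sub>M X.prior) \<Otimes>\<^sub>M prior)) < \<infinity>"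
    using U_second_moment[OF order_refl 0] by (auto simp: Om_def intro: le_less_trans)
qed (use s2 in simp)

definition "Y1 w = net_out d N L (fst (fst (fst w))) (snd (fst w)) + snd w"
  for w :: "((params \<times> params) \<times> (nat \<Rightarrow> real)) \<times> real"
definition "TX w = (snd (fst (fst w)), snd (fst w))"
  for w :: "((params \<times> params) \<times> (nat \<Rightarrow> real)) \<times> real"
definition "th w = fst (fst (fst w))"
  for w :: "((params \<times> params) \<times> (nat \<Rightarrow> real)) \<times> real"

lemma measurable_vars[measurable]:
  "Y1 \<in> borel_measurable JL" "TX \<in> JL \<rightarrow>\<^sub>M TS \<Otimes>\<^sub>M X_space d" "th \<in> JL \<rightarrow>\<^sub>M TS"
  unfolding Y1_def[abs_def] TX_def[abs_def] th_def[abs_def] by measurable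

lemma sets_prior_X: "sets (prior \<Otimes>\<^sub>M X.prior) = sets (TS \<Otimes>\<^sub>M X_space d)"
  by (intro sets_pair_measure_cong) (auto simp: X_space)

lemma TX_measurable: "TX \<in> JL \<rightarrow>\<^sub>M prior \<Otimes>\<^sub>M X.prior"
  using measurable_vars(2) by (simp only: measurable_cong_sets[OF refl sets_prior_X])

lemma law_full:
  "distr JL (borel \<Otimes>\<^sub>M R1) (\<lambda>w. (Y1 w, (th w, TX w))) = distr full.PP (borel \<Otimes>\<^sub>M R1) (\<lambda>u. (full.Y u, full.A u))"
proof (rule distr_eqI_nn_integral)
  fix G :: "real \<times> _ \<Rightarrow> ennreal" assume "G \<in> borel_measurable (borel \<Otimes>\<^sub>M R1)"
  then have [measurable]: "G \<in> borel_measurable (borel \<Otimes>\<^sub>M (TS \<Otimes>\<^sub>M (TS \<Otimes>\<^sub>M X_space d)))"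
    by (simp cong: measurable_cong_sets sets_pair_measure_cong)
  let ?f = "\<lambda>v. net_out d N L (fst v) (snd (snd v))"
  have "(\<integral>\<^sup>+w. G (Y1 w, (th w, TX w)) \<partial>JL) =
      (\<integral>\<^sup>+u. \<integral>\<^sup>+w. G (net_out d N L (fst (fst u)) (snd u) + w, (fst (fst u), (snd (fst u), snd u))) \<partial>gaussian (sqrt s2) \<partial>JX)"
    unfolding JL_def Y1_def th_def TX_def by (subst W.nn_integral_fst[symmetric]) simp_all
  also have "\<dots> = (\<integral>\<^sup>+v. \<integral>\<^sup>+w. G (?f v + w, v) \<partial>gaussian (sqrt s2) \<partial>R1)"
    by (subst nn_integral_R1) simp_all
  also have "\<dots> = (\<integral>\<^sup>+u. \<integral>\<^sup>+w. G (?f (fst u) + w, fst u) \<partial>gaussian (sqrt s2) \<partial>(R1 \<Otimes>\<^sub>M prior))"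
    using prior.emeasure_space_1 by (subst prior.nn_integral_fst[symmetric]) simp_all
  also have "\<dots> = (\<integral>\<^sup>+u. G (full.Y u, full.A u) \<partial>full.PP)"
    unfolding full.PP_def full.Y_def full.A_def by (subst W.nn_integral_fst[symmetric]) simp_all
  finally show "(\<integral>\<^sup>+w. G (Y1 w, (th w, TX w)) \<partial>JL) = (\<integral>\<^sup>+u. G (full.Y u, full.A u) \<partial>full.PP)" .
qed (measurable)

lemma law_part:
  "distr JL (borel \<Otimes>\<^sub>M (prior \<Otimes>\<^sub>M X.prior)) (\<lambda>w. (Y1 w, TX w)) =
    distr part.PP (borel \<Otimes>\<^sub>M (prior \<Otimes>\<^sub>M X.prior)) (\<lambda>u. (part.Y u, part.A u))"
proof (rule distr_eqI_nn_integral)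
  fix G :: "real \<times> _ \<Rightarrow> ennreal" assume "G \<in> borel_measurable (borel \<Otimes>\<^sub>M (prior \<Otimes>\<^sub>M X.prior))"
  then have [measurable]: "G \<in> borel_measurable (borel \<Otimes>\<^sub>M (TS \<Otimes>\<^sub>M X_space d))"
    by (simp add: sets_prior_X cong: measurable_cong_sets sets_pair_measure_cong)
  have [measurable]: "U L 0 \<in> borel_measurable Om" by (rule measurable_UV) (use L in \<open>simp_all add: width_def\<close>)
  have "(\<integral>\<^sup>+w. G (Y1 w, TX w) \<partial>JL) =
      (\<integral>\<^sup>+u. \<integral>\<^sup>+w. G (net_out d N L (fst (fst u)) (snd u) + w, (snd (fst u), snd u)) \<partial>gaussian (sqrt s2) \<partial>JX)"
    unfolding JL_def Y1_def th_def TX_def by (subst W.nn_integral_fst[symmetric]) simp_all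
  also have "\<dots> = (\<integral>\<^sup>+\<omega>. \<integral>\<^sup>+w. G (U L 0 \<omega> + w, (t \<omega>, x \<omega>)) \<partial>gaussian (sqrt s2) \<partial>Om)"
    by (subst nn_integral_JX) (simp_all add: U_def net_out_def[symmetric])
  also have "\<dots> = (\<integral>\<^sup>+u. G (part.Y u, part.A u) \<partial>part.PP)"
    unfolding part.PP_def part.Y_def part.A_def Om_def[symmetric]
    by (subst W.nn_integral_fst[symmetric]) (simp_all add: t_def x_def)
  finally show "(\<integral>\<^sup>+w. G (Y1 w, TX w) \<partial>JL) = (\<integral>\<^sup>+u. G (part.Y u, part.A u) \<partial>part.PP)" .
qed (intro measurable_Pair measurable_vars part.Y part.A TX_measurable)+

text \<open>Both models reproduce the same Y, so \<open>full.marg\<close> is a density of Y in the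
  partial model as well and the marginal term is common to both.\<close>

lemma law_Y1: "distr part.PP borel part.Y = density lborel (\<lambda>y. ennreal (full.marg y))"
proof -
  have "distr part.PP borel part.Y = distr JL borel Y1"
    by (rule distr_fst_cong[OF part.Y part.A measurable_vars(1) TX_measurable law_part[symmetric]])
  also have "\<dots> = distr full.PP borel full.Y"
    by (rule distr_fst_cong[OF _ _ _ _ law_full]) measurable
  finally show ?thesis by (simp add: full.law_Y)
qed

lemma condMI_le: "condMI JL borel TS (TS \<Otimes>\<^sub>M X_space d) Y1 th TX \<le> ennreal (ln (1 + real L * \<delta> / s2) / 2)"
proof -
  let ?h = "\<integral>y. ln (full.marg y) \<partial>density lborel (\<lambda>y. ennreal (full.marg y))"
  let ?H1 = "\<integral>u. ln (full.post (full.Y u, full.A u)) \<partial>full.PP"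
  let ?H2 = "\<integral>u. ln (part.post (part.Y u, part.A u)) \<partial>part.PP"
  have D1: "MI JL borel (TS \<Otimes>\<^sub>M (TS \<Otimes>\<^sub>M X_space d)) Y1 (\<lambda>w. (th w, TX w)) = ennreal (?H1 - ?h)"
  proof -
    have "MI JL borel (TS \<Otimes>\<^sub>M (TS \<Otimes>\<^sub>M X_space d)) Y1 (\<lambda>w. (th w, TX w)) = MI JL borel R1 Y1 (\<lambda>w. (th w, TX w))"
      by (rule MI_cong_sets) simp
    also have "\<dots> = MI full.PP borel R1 full.Y full.A"
      by (rule MI_cong_law[OF _ _ _ _ law_full]) measurable
    finally show ?thesis using full.MI_additive_noise(1)[OF _ full.marg_pos full.marg_le full.law_Y] by simp
  qed
  have D2: "MI JL borel (TS \<Otimes>\<^sub>M X_space d) Y1 TX = ennreal (?H2 - ?h)" "0 \<le> ?H2 - ?h"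
  proof -
    have "MI JL borel (TS \<Otimes>\<^sub>M X_space d) Y1 TX = MI JL borel (prior \<Otimes>\<^sub>M X.prior) Y1 TX"
      by (rule MI_cong_sets) (simp only: sets_prior_X)
    also have "\<dots> = MI part.PP borel (prior \<Otimes>\<^sub>M X.prior) part.Y part.A"
      by (rule MI_cong_law[OF measurable_vars(1) TX_measurable part.Y part.A law_part])
    finally show "MI JL borel (TS \<Otimes>\<^sub>M X_space d) Y1 TX = ennreal (?H2 - ?h)"
      using part.MI_additive_noise(1)[OF _ full.marg_pos full.marg_le law_Y1] by simp
    show "0 \<le> ?H2 - ?h"
      using part.MI_additive_noise(2)[OF _ full.marg_pos full.marg_le law_Y1] by simp
  qed
  have H1: "?H1 = - 1 / 2 - ln (2 * pi * s2) / 2"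
    using full.ln_post_noiseless[of "\<lambda>v. net_out d N L (fst v) (snd (snd v))"] s2 by simp
  define e where "e = real L * \<delta>"
  have e: "0 \<le> e" "0 < s2 + e" using \<delta>01 s2 by (auto simp: e_def intro: add_pos_nonneg)
  have H2: "- 1 / 2 - ln (2 * pi * (s2 + e)) / 2 \<le> ?H2"
  proof -
    let ?c = "\<lambda>v. net_out d N L (chan (sqrt (1 - \<delta>)) 0 (fst v) (fst v)) (snd v)"
    have c: "?c \<in> borel_measurable (prior \<Otimes>\<^sub>M X.prior)"
      unfolding measurable_cong_sets[OF sets_prior_X refl] by measurable
    have "(\<integral>\<^sup>+u. ennreal ((U L 0 u - ?c (fst u))\<^sup>2) \<partial>((prior \<Otimes>\<^sub>M X.prior) \<Otimes>\<^sub>M prior)) =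
        (\<integral>\<^sup>+u. ennreal ((U L 0 u - V L 0 u)\<^sup>2) \<partial>Om)"
      unfolding Om_def V_def t_def x_def net_out_def ..
    also have "\<dots> \<le> ennreal e" unfolding e_def by (rule UV_distance) (use L in \<open>simp_all add: width_def\<close>)
    \<comment> \<open>The choice \<tau>^2 = s2 + e turns the quadratic term into exactly -1/2,
      matching the one in \<open>H1\<close>.\<close>
    finally have "- ((sqrt s2)\<^sup>2 + e) / (2 * (sqrt (s2 + e))\<^sup>2) - ln (2 * pi * (sqrt (s2 + e))\<^sup>2) / 2 \<le> ?H2"
      using e by (intro part.ln_post_lower_bound(2)[OF c]) auto
    moreover have "(- s2 - e) / (2 * s2 + 2 * e) = - 1 / 2" using e by (simp add: field_simps)
    ultimately show ?thesis using e s2 by simp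
  qed
  have "?H1 - ?H2 \<le> ln (2 * pi * (s2 + e)) / 2 - ln (2 * pi * s2) / 2" using H1 H2 by simp
  also have "\<dots> = ln (1 + e / s2) / 2"
  proof -
    have "1 + e / s2 = (2 * pi * (s2 + e)) / (2 * pi * s2)" using s2 by (simp add: field_simps)
    then have "ln (1 + e / s2) = ln (2 * pi * (s2 + e)) - ln (2 * pi * s2)"
      using s2 e by (simp only: ln_div) simp
    then show ?thesis by (simp add: diff_divide_distrib)
  qed
  finally have le: "?H1 - ?H2 \<le> ln (1 + e / s2) / 2" .
  \<comment> \<open>The second mutual information is finite by \<open>D2\<close>, so the infinite
    branch of \<open>condMI\<close> is excluded.\<close>
  have "condMI JL borel TS (TS \<Otimes>\<^sub>M X_space d) Y1 th TX = ennreal (?H1 - ?h) - ennreal (?H2 - ?h)"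
    unfolding condMI_def D1 D2(1) by simp
  \<comment> \<open>Subtraction in ennreal agrees with real subtraction here because the subtrahend
    is nonnegative; \<open>?h\<close> cancels.\<close>
  also have "\<dots> = ennreal (?H1 - ?H2)" using D2(2) by (simp add: ennreal_minus)
  also have "\<dots> \<le> ennreal (ln (1 + e / s2) / 2)" by (intro ennreal_leI le)
  finally show ?thesis by (simp add: e_def)
qed

lemma rate_distortion_le:
  assumes "ln (1 + real L * \<delta> / s2) / 2 \<le> eps"
  shows "dnn_rate_distortion d N L s2 eps \<le> ennreal (real (card (param_index d N L)) / 2 * ln (1 / \<delta>))"
proof -
  have "condMI JL borel TS (TS \<Otimes>\<^sub>M X_space d) Y1 th TX \<le> ennreal eps"
    using condMI_le ennreal_leI[OF assms] by (rule order_trans)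
  then have "condMI (joint_law d N L s2 K) borel TS (TS \<Otimes>\<^sub>M X_space d)
      (\<lambda>(((\<theta>, a), b), w). net_out d N L \<theta> b + w) (\<lambda>(((\<theta>, a), b), w). \<theta>)
      (\<lambda>w. ((\<lambda>(((\<theta>, a), b), w). a) w, (\<lambda>(((\<theta>, a), b), w). b) w)) \<le> ennreal eps"
    by (simp add: joint_law_K Y1_def[abs_def] th_def[abs_def] TX_def[abs_def] split_beta')
  moreover have "MI (joint_law d N L s2 K) TS TS (\<lambda>(((\<theta>, a), b), w). \<theta>) (\<lambda>(((\<theta>, a), b), w). a) =
      ennreal (real (card (param_index d N L)) / 2 * ln (1 / \<delta>))"
    using MI_channel by (simp add: joint_law_K split_beta')
  ultimately show ?thesis
    unfolding dnn_rate_distortion_def Let_def Theta_space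
    using K_measurable by (intro INF_lower2[of K]) auto
qed

end

theorem mainTheorem9:
  fixes d N L :: nat and s2 eps :: real
  assumes "d \<ge> 1" and "N \<ge> 1" and "L \<ge> 2" and "s2 > 0" and "eps > 0"
  shows "dnn_rate_distortion d N L s2 eps
           \<le> ennreal ((real (L - 2) * real N ^ 2 + real N + real d * real N) / 2
                 * ln (1 + 1 / (s2 * (exp (2 * eps / real L) - 1))))"
proof -
  define a where "a = exp (2 * eps / real L) - 1"
  \<comment> \<open>Solves 1 / \<delta> = 1 + 1 / (s2 * a), so the cost per weight is exactly half
    the claimed logarithm.\<close>
  define \<delta> where "\<delta> = s2 * a / (s2 * a + 1)"
  have a: "0 < a" using assms by (simp add: a_def)
  have sa: "0 < s2 * a" using a assms by simp
  have dl: "0 < \<delta>" "\<delta> < 1" using sa by (auto simp: \<delta>_def)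
  interpret noisy_dnn d N L \<delta> s2
    by unfold_locales (use assms dl in auto)
  \<comment> \<open>With \<delta> fixed by the rate, the distortion bound uses only \<delta> \<le>
    s2 * a, as the denominator of \<delta> is at least 1.\<close>
  have "\<delta> \<le> s2 * a / 1" unfolding \<delta>_def using sa by (intro divide_left_mono) auto
  then have "\<delta> / s2 \<le> a" using assms by (simp add: pos_divide_le_eq mult.commute)
  then have "real L * (\<delta> / s2) \<le> real L * a" by (intro mult_left_mono) auto
  then have "1 + real L * \<delta> / s2 \<le> 1 + real L * a" by simp
  \<comment> \<open>The division by L in the exponent of a is made for this: the power equals exp (2
    * eps).\<close>
  also have "\<dots> \<le> (1 + a) ^ L" using Bernoulli_inequality[of a L] a by simp
  also have "\<dots> = exp (2 * eps)" using assms by (simp add: a_def exp_of_nat_mult[symmetric])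
  finally have "ln (1 + real L * \<delta> / s2) \<le> ln (exp (2 * eps))"
    using dl assms by (intro ln_mono) (auto intro!: add_pos_nonneg)
  then have "dnn_rate_distortion d N L s2 eps \<le> ennreal (real (card (param_index d N L)) / 2 * ln (1 / \<delta>))"
    by (intro rate_distortion_le) simp
  also have "1 / \<delta> = 1 + 1 / (s2 * a)" using a assms(4) by (simp add: \<delta>_def field_simps)
  also have "real (card (param_index d N L)) = real (L - 2) * real N ^ 2 + real N + real d * real N"
    using assms by (simp add: card_param_index)
  finally show ?thesis by (simp add: a_def)
qed

end
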